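(* If $X$ is a finite $T_0$ space and $F,G:X\multimap X$ are homotopic strongly upper semicontinuous multivalued maps with acyclic values, then $F_*=G_*:H_n(X)\to H_n(X)$ for every $n\ge 0$. In particular, $L(F)=L(G)$.
   Context: A multivalued map $F:X\multimap Y$ assigns to each $x\in X$ a subset $F(x)\subset Y$. For $X$ a topological space and $Y$ a set, $F$ is strongly upper semicontinuous (susc) if for every subset $B\subset Y$ the set $\{x\in X: F(x)\subset B\}$ is open in $X$. $F$ has acyclic values if each $F(x)$ (with the subspace topology) is acyclic, i.e. nonempty with all reduced singular homology groups with integer coefficients trivial. $H_n$ denotes unreduced singular homology with integer coefficients. Homotopy: two susc multivalued maps $F,G:X\multimap Y$ with acyclic values ($X$ a finite $T_0$ space, $Y$ a topological space) are homotopic if there exists a susc multivalued map $H:X\times[0,1]\multimap Y$ with acyclic values such that $H(x,0)=F(x)$ and $H(x,1)=G(x)$ for every $x\in X$. Induced map: for $X$ a finite $T_0$ space, $Y$ a topological space and $F:X\multimap Y$ susc with acyclic values, regard $F$ as the subspace $\{(x,y):y\in F(x)\}\subset X\times Y$ with projections $p_1:F\to X$, $p_2:F\to Y$; then $(p_1)_*:H_n(F)\to H_n(X)$ is an isomorphism for all $n$, and $F_*:=(p_2)_*(p_1)_*^{-1}:H_n(X)\to H_n(Y)$. Lefschetz number: for $F:X\multimap X$, $L(F)=\sum_{n\ge 0}(-1)^n\operatorname{tr}(F_n)$, where $\operatorname{tr}(F_n)$ is the trace of the endomorphism of $H_n(X)/T_n(X)$ induced by $F_*$, with $T_n(X)$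 the torsion subgroup of $H_n(X)$. *)

theory Defs
  imports "HOL-Analysis.Analysis" "HOL-Homology.Homology"
begin

section \<open>Multivalued maps\<close>

text \<open>A multivalued map from \<open>X\<close> to \<open>Y\<close> is a function \<open>F :: 'a \<Rightarrow> 'b set\<close> whose values over the
  points of \<open>X\<close> are subsets of \<open>Y\<close>; what it does off \<open>X\<close> is irrelevant.\<close>

definition multivalued_map :: "'a set \<Rightarrow> 'b set \<Rightarrow> ('a \<Rightarrow> 'b set) \<Rightarrow> bool" where
  "multivalued_map X Y F \<longleftrightarrow> (\<forall>x\<in>X. F x \<subseteq> Y)"

definition susc :: "'a topology \<Rightarrow> 'b set \<Rightarrow> ('a \<Rightarrow> 'b set) \<Rightarrow> bool" where
  "susc X Y F \<longleftrightarrow> multivalued_map (topspace X) Y F \<and>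
     (\<forall>B. B \<subseteq> Y \<longrightarrow> openin X {x \<in> topspace X. F x \<subseteq> B})"

definition acyclic_space :: "'a topology \<Rightarrow> bool" where
  "acyclic_space X \<longleftrightarrow>
     topspace X \<noteq> {} \<and> (\<forall>p. trivial_group (reduced_homology_group p X))"

definition acyclic_values :: "'a topology \<Rightarrow> 'b topology \<Rightarrow> ('a \<Rightarrow> 'b set) \<Rightarrow> bool" where
  "acyclic_values X Y F \<longleftrightarrow> (\<forall>x\<in>topspace X. acyclic_space (subtopology Y (F x)))"

definition susc_homotopic ::
    "'a topology \<Rightarrow> 'b topology \<Rightarrow> ('a \<Rightarrow> 'b set) \<Rightarrow> ('a \<Rightarrow> 'b set) \<Rightarrow> bool" where
  "susc_homotopic X Y F G \<longleftrightarrow>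
     (\<exists>H. susc (prod_topology X (top_of_set {0..1::real})) (topspace Y) H \<and>
          acyclic_values (prod_topology X (top_of_set {0..1::real})) Y H \<and>
          (\<forall>x\<in>topspace X. H (x, 0) = F x \<and> H (x, 1) = G x))"

section \<open>The induced map in homology\<close>

definition graph_space :: "'a topology \<Rightarrow> 'b topology \<Rightarrow> ('a \<Rightarrow> 'b set) \<Rightarrow> ('a \<times> 'b) topology" where
  "graph_space X Y F = subtopology (prod_topology X Y) {(x, y). x \<in> topspace X \<and> y \<in> F x}"

text \<open>\<open>(p\<^sub>2)\<^sub>* \<circ> (p\<^sub>1)\<^sub>*\<^sup>-\<^sup>1\<close>, where \<open>p\<^sub>1\<close>, \<open>p\<^sub>2\<close> are the projections of the graph. For \<open>X\<close> finite \<open>T\<^sub>0\<close>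
  and \<open>F\<close> susc with acyclic values \<open>(p\<^sub>1)\<^sub>*\<close> is an isomorphism, so that the \<open>inv_into\<close> below is
  its genuine inverse. As for \<open>hom_induced\<close>, only the values on the carrier are meaningful.\<close>

definition mv_hom_induced ::
    "int \<Rightarrow> 'a topology \<Rightarrow> 'b topology \<Rightarrow> ('a \<Rightarrow> 'b set) \<Rightarrow> 'a chain set \<Rightarrow> 'b chain set" where
  "mv_hom_induced p X Y F =
     hom_induced p (graph_space X Y F) {} Y {} snd \<circ>
     inv_into (carrier (homology_group p (graph_space X Y F)))
       (hom_induced p (graph_space X Y F) {} X {} fst)"

section \<open>Traces and the Lefschetz number\<close>

text \<open>Abelian groups are written multiplicatively, as in the homology library.\<close>

definition torsion_subgroup :: "('g, 'm) monoid_scheme \<Rightarrow> 'g set" where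
  "torsion_subgroup A = {x \<in> carrier A. \<exists>k::nat. k > 0 \<and> x [^]\<^bsub>A\<^esub> k = \<one>\<^bsub>A\<^esub>}"

text \<open>The map \<open>A/N \<rightarrow> A/N\<close> sending the coset of \<open>x\<close> to the coset of \<open>f x\<close>; well defined whenever
  \<open>f\<close> is an endomorphism of \<open>A\<close> that maps \<open>N\<close> into itself.\<close>

definition quotient_endo ::
    "('g, 'm) monoid_scheme \<Rightarrow> 'g set \<Rightarrow> ('g \<Rightarrow> 'g) \<Rightarrow> 'g set \<Rightarrow> 'g set" where
  "quotient_endo A N f C = the_elem ((\<lambda>x. N #>\<^bsub>A\<^esub> f x) ` C)"

definition integer_coords ::
    "('g, 'm) monoid_scheme \<Rightarrow> 'g set \<Rightarrow> 'g \<Rightarrow> ('g \<Rightarrow> int) \<Rightarrow> bool" where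
  "integer_coords A B x c \<longleftrightarrow>
     c \<in> B \<rightarrow>\<^sub>E UNIV \<and> x = finprod A (\<lambda>b. b [^]\<^bsub>A\<^esub> c b) B"

definition finite_free_basis :: "('g, 'm) monoid_scheme \<Rightarrow> 'g set \<Rightarrow> bool" where
  "finite_free_basis A B \<longleftrightarrow>
     finite B \<and> B \<subseteq> carrier A \<and> (\<forall>x\<in>carrier A. \<exists>!c. integer_coords A B x c)"

definition basis_trace :: "('g, 'm) monoid_scheme \<Rightarrow> 'g set \<Rightarrow> ('g \<Rightarrow> 'g) \<Rightarrow> int" where
  "basis_trace A B f = (\<Sum>b\<in>B. (THE c. integer_coords A B (f b) c) b)"

text \<open>The trace of an endomorphism of a finitely generated free abelian group. It does not depend on
  the basis chosen.\<close>

definition endo_trace :: "('g, 'm) monoid_scheme \<Rightarrow> ('g \<Rightarrow> 'g) \<Rightarrow> int" where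
  "endo_trace A f = basis_trace A (SOME B. finite_free_basis A B) f"

text \<open>\<open>Sum_any\<close> is the sum over the finite support: the homology groups of a finite space are finitely
  generated and vanish in large degrees.\<close>

definition lefschetz_number :: "'a topology \<Rightarrow> ('a \<Rightarrow> 'a set) \<Rightarrow> int" where
  "lefschetz_number X F =
     Sum_any (\<lambda>n::nat.
       let A = homology_group (int n) X; T = torsion_subgroup A
       in (- 1) ^ n * endo_trace (A Mod T) (quotient_endo A T (mv_hom_induced (int n) X X F)))"

end

theory Submission
  imports Defs
begin

text \<open>A map into a finite \<open>T\<^sub>0\<close> space that is a homology isomorphism over every minimal open set is one
  over every open set (McCord): remove a closed point \<open>x\<close> of the open set, compare by excision with
  the minimal neighbourhood of \<open>x\<close>, and apply the five lemma. The first projection of the graph of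
  \<open>F\<close> qualifies, as its part over the minimal neighbourhood of \<open>x\<close> is homotopy equivalent to \<open>F x\<close>.
  If \<open>F x \<subseteq> G x\<close> for all \<open>x\<close>, inclusion of graphs then shows that \<open>F\<close> and \<open>G\<close> induce the same map.
  In a homotopy \<open>H\<close>, strong upper semicontinuity gives \<open>H (x, s) \<subseteq> H (x, t)\<close> for all \<open>x\<close> whenever
  \<open>s\<close> is close to \<open>t\<close>, so the induced map is locally constant in \<open>t\<close>, hence constant.\<close>

section \<open>The five lemma\<close>

text \<open>Two out of three for bijections. In a commuting square built from two excision maps, it
  carries an isomorphism from one vertical side to the other.\<close>

lemma iso_cancel_right:
  assumes "e \<in> iso A B" "k \<in> hom B C" "h \<in> iso A C" "\<And>x. x \<in> carrier A \<Longrightarrow> k (e x) = h x"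
  shows "k \<in> iso B C"
proof -
  have e: "bij_betw e (carrier A) (carrier B)" and h: "bij_betw h (carrier A) (carrier C)"
    using assms by (auto simp: iso_def)
  have "bij_betw (k \<circ> e) (carrier A) (carrier C)"
    using h assms(4) by (metis (no_types, lifting) bij_betw_cong comp_apply)
  then have "bij_betw k (carrier B) (carrier C)"
    using bij_betw_comp_iff e by blast
  then show ?thesis
    using assms(2) by (simp add: iso_def)
qed

lemma iso_cancel_left:
  assumes "e \<in> iso B C" "k \<in> hom A B" "h \<in> iso A C" "\<And>x. x \<in> carrier A \<Longrightarrow> e (k x) = h x"
  shows "k \<in> iso A B"
proof -
  have e: "bij_betw e (carrier B) (carrier C)" and h: "bij_betw h (carrier A) (carrier C)"
    using assms by (auto simp: iso_def)
  have k: "k ` carrier A \<subseteq> carrier B"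
    using assms(2) by (auto simp: hom_def)
  have "bij_betw (e \<circ> k) (carrier A) (carrier C)"
    using h assms(4) by (metis (no_types, lifting) bij_betw_cong comp_apply)
  then have "bij_betw k (carrier A) (carrier B)"
    using bij_betw_comp_iff2[OF e k] by blast
  then show ?thesis
    using assms(2) by (simp add: iso_def)
qed

text \<open>The usual diagram chase. Exactness is given as overlapping three-term pieces because the
  long exact sequence of a pair is available in that form.\<close>

lemma five_lemma_iso:
  assumes A: "exact_seq ([A3, A2, A1], [f2, f1])" "exact_seq ([A4, A3, A2], [f3, f2])"
      "exact_seq ([A5, A4, A3], [f4, f3])"
    and B: "exact_seq ([B3, B2, B1], [g2, g1])" "exact_seq ([B4, B3, B2], [g3, g2])"
      "exact_seq ([B5, B4, B3], [g4, g3])"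
    and h: "h1 \<in> iso A1 B1" "h2 \<in> iso A2 B2" "h3 \<in> hom A3 B3" "h4 \<in> iso A4 B4" "h5 \<in> iso A5 B5"
    and comm: "\<And>x. x \<in> carrier A1 \<Longrightarrow> h2 (f1 x) = g1 (h1 x)"
      "\<And>x. x \<in> carrier A2 \<Longrightarrow> h3 (f2 x) = g2 (h2 x)"
      "\<And>x. x \<in> carrier A3 \<Longrightarrow> h4 (f3 x) = g3 (h3 x)"
      "\<And>x. x \<in> carrier A4 \<Longrightarrow> h5 (f4 x) = g4 (h4 x)"
  shows "h3 \<in> iso A3 B3"
proof -
  interpret A2: group A2 using A by (auto simp: group_hom_def)
  interpret A3: group A3 using A by (auto simp: group_hom_def)
  interpret A4: group A4 using A by auto
  interpret A5: group A5 using A by (auto simp: group_hom_def)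
  interpret B3: group B3 using B by auto
  interpret B4: group B4 using B by auto
  interpret f1: group_hom A1 A2 f1 using A by auto
  interpret f2: group_hom A2 A3 f2 using A by auto
  interpret f3: group_hom A3 A4 f3 using A by (auto simp: group_hom_def group_hom_axioms_def)
  interpret f4: group_hom A4 A5 f4 using A by (auto simp: group_hom_def group_hom_axioms_def)
  interpret g1: group_hom B1 B2 g1 using B by auto
  interpret g2: group_hom B2 B3 g2 using B by auto
  interpret g3: group_hom B3 B4 g3 using B by (auto simp: group_hom_def group_hom_axioms_def)
  interpret g4: group_hom B4 B5 g4 using B by (auto simp: group_hom_def group_hom_axioms_def)
  interpret h1: group_hom A1 B1 h1 using h by (simp add: group_hom_def group_hom_axioms_def iso_def)
  interpret h2: group_hom A2 B2 h2 using h by (simp add: group_hom_def group_hom_axioms_def iso_def)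
  interpret h3: group_hom A3 B3 h3 using h by (simp add: group_hom_def group_hom_axioms_def)
  interpret h4: group_hom A4 B4 h4 using h by (simp add: group_hom_def group_hom_axioms_def iso_def)
  interpret h5: group_hom A5 B5 h5 using h by (simp add: group_hom_def group_hom_axioms_def iso_def)
  have exA: "kernel A3 A4 f3 = f2 ` carrier A2" "kernel A2 A3 f2 = f1 ` carrier A1"
      "kernel A4 A5 f4 = f3 ` carrier A3"
    using A by auto
  have exB: "kernel B3 B4 g3 = g2 ` carrier B2" "kernel B2 B3 g2 = g1 ` carrier B1"
      "kernel B4 B5 g4 = g3 ` carrier B3"
    using B by auto
  have inj: "inj_on h2 (carrier A2)" "inj_on h4 (carrier A4)" "inj_on h5 (carrier A5)"
    and surj: "h1 ` carrier A1 = carrier B1" "h2 ` carrier A2 = carrier B2" "h4 ` carrier A4 = carrier B4"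
    using h by (auto simp: iso_def bij_betw_def)
  have mono: "x = \<one>\<^bsub>A3\<^esub>" if x: "x \<in> carrier A3" "h3 x = \<one>\<^bsub>B3\<^esub>" for x
  proof -
    have "h4 (f3 x) = h4 \<one>\<^bsub>A4\<^esub>"
      using comm(3) x by simp
    then have "f3 x = \<one>\<^bsub>A4\<^esub>"
      using inj(2) x by (meson A4.one_closed f3.hom_closed inj_onD)
    then have "x \<in> f2 ` carrier A2"
      using x exA(1) by (auto simp: kernel_def)
    then obtain y where y: "y \<in> carrier A2" "x = f2 y" by auto
    then have "g2 (h2 y) = \<one>\<^bsub>B3\<^esub>"
      using comm(2) x by metis
    then have "h2 y \<in> g1 ` carrier B1"
      using y exB(2) by (auto simp: kernel_def)
    then obtain z where z: "z \<in> carrier A1" "h2 y = g1 (h1 z)"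
      using surj(1) by (metis imageE)
    then have "h2 y = h2 (f1 z)"
      using comm(1) by simp
    then have "y = f1 z"
      using inj(1) y z by (simp add: inj_on_eq_iff)
    then show ?thesis
      using exA(2) y z by (auto simp: kernel_def)
  qed
  have epi: "y \<in> h3 ` carrier A3" if y: "y \<in> carrier B3" for y
  proof -
    have "g3 y \<in> h4 ` carrier A4"
      using surj(3) y by simp
    then obtain z where z: "z \<in> carrier A4" "g3 y = h4 z"
      by auto
    have "g4 (g3 y) = \<one>\<^bsub>B5\<^esub>"
      using exB(3) y by (auto simp: kernel_def)
    then have "h5 (f4 z) = h5 \<one>\<^bsub>A5\<^esub>"
      using comm(4) z by simp
    then have "f4 z = \<one>\<^bsub>A5\<^esub>"
      using inj(3) z by (meson A5.one_closed f4.hom_closed inj_onD)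
    then have "z \<in> f3 ` carrier A3"
      using z exA(3) by (auto simp: kernel_def)
    then obtain x where x: "x \<in> carrier A3" "z = f3 x" by auto
    \<comment> \<open>The element \<open>h3 x\<close> agrees with \<open>y\<close> only up to the
      kernel of \<open>g3\<close>. By exactness the discrepancy comes from \<open>B2\<close>, hence
      from some \<open>w\<close> in \<open>A2\<close>, and \<open>f2 w\<close> corrects
      \<open>x\<close>.\<close>
    have "g3 (y \<otimes>\<^bsub>B3\<^esub> inv\<^bsub>B3\<^esub> (h3 x)) = \<one>\<^bsub>B4\<^esub>"
      using x y z comm(3) by simp
    then have "y \<otimes>\<^bsub>B3\<^esub> inv\<^bsub>B3\<^esub> (h3 x) \<in> g2 ` carrier B2"
      using x y exB(1) by (auto simp: kernel_def)
    then obtain w where w: "w \<in> carrier A2" "y \<otimes>\<^bsub>B3\<^esub> inv\<^bsub>B3\<^esub> (h3 x) = g2 (h2 w)"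
      using surj(2) by (metis imageE)
    then have "h3 (f2 w \<otimes>\<^bsub>A3\<^esub> x) = (y \<otimes>\<^bsub>B3\<^esub> inv\<^bsub>B3\<^esub> (h3 x)) \<otimes>\<^bsub>B3\<^esub> h3 x"
      using comm(2) x by simp
    also have "\<dots> = y"
      using x y by (simp add: B3.m_assoc)
    finally show ?thesis
      using x w by (metis A3.m_closed f2.hom_closed imageI)
  qed
  have "inj_on h3 (carrier A3)"
    using mono by (simp add: h3.inj_on_one_iff)
  with epi show ?thesis
    using h(3) by (auto simp: iso_def bij_betw_def)
qed

section \<open>Noetherian abelian groups\<close>

text \<open>Finite generation is demanded of every subgroup, so that it is inherited by the kernels
  and preimages that occur in exact sequences.\<close>

definition noetherian_group :: "('g, 'm) monoid_scheme \<Rightarrow> bool" where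
  "noetherian_group A \<longleftrightarrow>
     comm_group A \<and> (\<forall>H. subgroup H A \<longrightarrow> (\<exists>S. finite S \<and> S \<subseteq> carrier A \<and> generate A S = H))"

text \<open>A subgroup \<open>H\<close> of \<open>B\<close> is generated by lifts of finitely many
  generators of its image in \<open>C\<close>, together with the images of finitely many generators
  of its preimage in \<open>A\<close>. Exactness is asked at \<open>B\<close> alone, which fits any
  three consecutive terms of a long exact sequence.\<close>

lemma noetherian_group_exact:
  assumes "noetherian_group A" "noetherian_group C" "comm_group B"
    and f: "f \<in> hom A B" and g: "g \<in> hom B C" and ker: "kernel B C g = f ` carrier A"
  shows "noetherian_group B"
proof -
  interpret A: comm_group A using assms by (simp add: noetherian_group_def)
  interpret B: comm_group B by fact
  interpret C: comm_group C using assms by (simp add: noetherian_group_def)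
  interpret f: group_hom A B f using f by unfold_locales
  interpret g: group_hom B C g using g by unfold_locales
  have "\<exists>S. finite S \<and> S \<subseteq> carrier B \<and> generate B S = H" if H: "subgroup H B" for H
  proof -
    have Hc: "H \<subseteq> carrier B"
      using H subgroup.subset by blast
    have "subgroup (g ` H) C"
      using H by (rule g.subgroup_img_is_subgroup)
    then obtain S where S: "finite S" "S \<subseteq> carrier C" "generate C S = g ` H"
      using assms(2) unfolding noetherian_group_def by blast
    have "S \<subseteq> g ` H"
      using S(3) generate.incl[of _ S C] by blast
    then obtain S' where S': "finite S'" "S' \<subseteq> H" "S = g ` S'"
      using S(1) by (meson finite_subset_image)
    let ?K = "{a \<in> carrier A. f a \<in> H}"
    have "subgroup ?K A"
      by (rule subgroup.intro) (auto simp: H subgroup.m_closed subgroup.m_inv_closed subgroup.one_closed)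
    then obtain R where R: "finite R" "R \<subseteq> carrier A" "generate A R = ?K"
      using assms(1) unfolding noetherian_group_def by blast
    have RK: "R \<subseteq> ?K"
      using R(3) generate.incl[of _ R A] by blast
    have sub: "S' \<union> f ` R \<subseteq> carrier B"
      using S' Hc R by auto
    have "generate B (S' \<union> f ` R) \<subseteq> H"
      using RK S' by (intro B.generate_subgroup_incl H) auto
    moreover have "h \<in> generate B (S' \<union> f ` R)" if h: "h \<in> H" for h
    proof -
      have S'c: "S' \<subseteq> carrier B"
        using S' Hc by blast
      have "g h \<in> g ` generate B S'"
        using S(3) S'(3) h g.generate_img[OF S'c] by auto
      then obtain s where s: "s \<in> generate B S'" "g h = g s" by auto
      have sH: "s \<in> H"
        using B.generate_subgroup_incl[OF S'(2) H] s(1) by blast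
      have hc: "h \<in> carrier B" and sc: "s \<in> carrier B"
        using h sH Hc by auto
      \<comment> \<open>After division by a word \<open>s\<close> in the lifts with the same image
        in \<open>C\<close>, what remains of \<open>h\<close> comes from \<open>A\<close> and still
        lies in \<open>H\<close>, so the generators \<open>R\<close> account for it.\<close>
      have "h \<otimes>\<^bsub>B\<^esub> inv\<^bsub>B\<^esub> s \<in> kernel B C g"
        using hc sc s(2) by (simp add: kernel_def)
      then obtain a where a: "a \<in> carrier A" "h \<otimes>\<^bsub>B\<^esub> inv\<^bsub>B\<^esub> s = f a"
        using ker by auto
      have "f a \<in> H"
        using H h sH a(2) by (metis subgroup.m_closed subgroup.m_inv_closed)
      then have "f a \<in> f ` generate A R"
        using a R(3) by blast
      then have "f a \<in> generate B (f ` R)"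
        using f.generate_img[OF R(2)] by simp
      then have 1: "f a \<in> generate B (S' \<union> f ` R)"
        using B.mono_generate[of "f ` R" "S' \<union> f ` R"] by blast
      have 2: "s \<in> generate B (S' \<union> f ` R)"
        using B.mono_generate[of S' "S' \<union> f ` R"] s(1) by blast
      have "h = f a \<otimes>\<^bsub>B\<^esub> s"
        using a(2)[symmetric] hc sc by (simp add: B.m_assoc)
      then show ?thesis
        using generate.eng[OF 1 2] by simp
    qed
    ultimately have "generate B (S' \<union> f ` R) = H" by blast
    then show ?thesis
      using S'(1) R(1) sub by (intro exI[of _ "S' \<union> f ` R"]) simp
  qed
  then show ?thesis
    by (simp add: noetherian_group_def B.comm_group_axioms)
qed

lemma noetherian_group_exact_seq:
  assumes "exact_seq ([C, B, A], [g, f])" "noetherian_group A" "noetherian_group C" "comm_group B"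
  shows "noetherian_group B"
proof (rule noetherian_group_exact[OF assms(2-4)])
  show "f \<in> hom A B" "g \<in> hom B C" "kernel B C g = f ` carrier A"
    using assms(1) by (auto simp: group_hom_def group_hom_axioms_def)
qed

lemma noetherian_group_trivial:
  assumes "trivial_group A"
  shows "noetherian_group A"
proof -
  interpret group A
    using assms by (simp add: trivial_group_def)
  have A: "carrier A = {\<one>\<^bsub>A\<^esub>}"
    using assms by (simp add: trivial_group_def)
  have "comm_group A"
    by (rule group_comm_groupI) (use A in auto)
  moreover have "generate A {} = H" if "subgroup H A" for H
    using subgroup.one_closed[OF that] subgroup.subset[OF that] A generate_empty by auto
  ultimately show ?thesis
    unfolding noetherian_group_def by blast
qed

text \<open>Surjectivity of \<open>f\<close> is exactness at \<open>B\<close> once the trivial group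
  is put in the third place.\<close>

lemma noetherian_group_epi:
  assumes "noetherian_group A" "comm_group B" "f \<in> hom A B" "f ` carrier A = carrier B"
  shows "noetherian_group B"
proof (rule noetherian_group_exact[OF assms(1) _ assms(2,3)])
  show "noetherian_group (singleton_group (undefined :: unit))"
    by (simp add: noetherian_group_trivial)
  show "(\<lambda>_. undefined :: unit) \<in> hom B (singleton_group (undefined :: unit))"
    by (auto simp: hom_def singleton_group_def)
  show "kernel B (singleton_group (undefined :: unit)) (\<lambda>_. undefined) = f ` carrier A"
    using assms(4) by (auto simp: kernel_def singleton_group_def)
qed

text \<open>Division with remainder by the least positive element shows that every subgroup is
  cyclic. The integers enter later as the zeroth homology of a contractible space.\<close>

lemma noetherian_integer_group: "noetherian_group integer_group"
proof -
  interpret comm_group integer_group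
    by (rule abelian_integer_group)
  have "\<exists>d. generate integer_group {d} = H" if H: "subgroup H integer_group" for H
  proof -
    have mult: "k * h \<in> H" if "h \<in> H" for h k
      using subgroup_int_pow_closed[OF H that, of k] by simp
    have diff: "a - b \<in> H" if "a \<in> H" "b \<in> H" for a b
      using subgroup.m_closed[OF H that(1) subgroup.m_inv_closed[OF H that(2)]] by simp
    have gen: "generate integer_group {d} = range (\<lambda>k. k * d)" for d
      by (simp add: generate_pow full_SetCompr_eq)
    have z: "0 \<in> H"
      using subgroup.one_closed[OF H] by simp
    show ?thesis
    proof (cases "H \<subseteq> {0}")
      case True
      then have "generate integer_group {0} = H"
        using z by (auto simp: gen)
      then show ?thesis by blast
    next
      case False
      then obtain h where h: "h \<in> H" "h \<noteq> 0" by blast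
      have "\<bar>h\<bar> \<in> H"
        using mult[OF h(1), of "sgn h"] by (simp add: mult_sgn_abs abs_sgn mult.commute)
      then have ex: "int (nat \<bar>h\<bar>) \<in> H \<and> nat \<bar>h\<bar> > 0"
        using h(2) by simp
      define d where "d = (LEAST n. int n \<in> H \<and> n > 0)"
      have d: "int d \<in> H" "d > 0"
        using LeastI[of "\<lambda>n. int n \<in> H \<and> n > 0", OF ex] by (auto simp: d_def)
      have "a \<in> range (\<lambda>k. k * int d)" if a: "a \<in> H" for a
      proof -
        have r: "a mod int d \<in> H"
          using diff[OF a mult[OF d(1), of "a div int d"]] by (simp add: minus_div_mult_eq_mod)
        have "a mod int d = 0"
        proof (rule ccontr)
          assume n0: "a mod int d \<noteq> 0"
          have bnd: "0 \<le> a mod int d" "a mod int d < int d"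
            using d(2) by auto
          have "int (nat (a mod int d)) \<in> H \<and> nat (a mod int d) > 0"
            using r bnd n0 by simp
          then have "d \<le> nat (a mod int d)"
            unfolding d_def by (rule Least_le)
          then show False
            using bnd by linarith
        qed
        then have "a = (a div int d) * int d"
          by (metis add.right_neutral div_mult_mod_eq)
        then show ?thesis by blast
      qed
      then have "generate integer_group {int d} = H"
        using mult[OF d(1)] by (auto simp: gen)
      then show ?thesis by blast
    qed
  qed
  then show ?thesis
    unfolding noetherian_group_def
    by (metis abelian_integer_group carrier_integer_group finite.emptyI finite.insertI subset_UNIV)
qed

section \<open>Bases of finitely generated torsion-free abelian groups\<close>

context comm_group
begin

text \<open>By induction on the generated element: the exponent functions are zero, an indicator,
  its negative, and sums of exponent functions.\<close>

lemma generate_subset_integer_combinations: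
  assumes "finite B" "B \<subseteq> carrier G"
  shows "generate G B \<subseteq> range (\<lambda>c::'a \<Rightarrow> int. finprod G (\<lambda>b. b [^] c b) B)"
proof
  fix x assume "x \<in> generate G B"
  then show "x \<in> range (\<lambda>c::'a \<Rightarrow> int. finprod G (\<lambda>b. b [^] c b) B)"
  proof (induction rule: generate.induct)
    case one
    have "\<one> = finprod G (\<lambda>b. b [^] (0::int)) B"
      by (rule finprod_one_eqI[symmetric]) auto
    then show ?case
      by (rule range_eqI[where x = "\<lambda>_. 0"])
  next
    case (incl h)
    have *: "finprod G (\<lambda>b. b [^] (if b = h then 1 else 0::int)) B = h"
    proof -
      have "finprod G (\<lambda>b. b [^] (if b = h then 1 else 0::int)) B
          = finprod G (\<lambda>b. if b = h then b else \<one>) B"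
        using assms by (intro finprod_cong') auto
      also have "\<dots> = h"
        using assms by (intro finprod_singleton_swap[OF incl]) auto
      finally show ?thesis .
    qed
    show ?case
      by (rule range_eqI[where x = "\<lambda>b. if b = h then 1 else 0 :: int"]) (rule *[symmetric])
  next
    case (inv h)
    have *: "finprod G (\<lambda>b. b [^] (if b = h then -1 else 0::int)) B = inv h"
    proof -
      have "finprod G (\<lambda>b. b [^] (if b = h then -1 else 0::int)) B
          = finprod G (\<lambda>b. if b = h then inv b else \<one>) B"
        using assms by (intro finprod_cong') (auto simp: int_pow_neg subset_iff)
      also have "\<dots> = inv h"
        using assms by (intro finprod_singleton_swap[OF inv]) auto
      finally show ?thesis .
    qed
    show ?case
      by (rule range_eqI[where x = "\<lambda>b. if b = h then -1 else 0 :: int"]) (rule *[symmetric])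
  next
    case (eng h1 h2)
    then obtain c d :: "'a \<Rightarrow> int" where cd: "h1 = finprod G (\<lambda>b. b [^] c b) B"
        "h2 = finprod G (\<lambda>b. b [^] d b) B"
      by blast
    have "finprod G (\<lambda>b. b [^] (c b + d b)) B = finprod G (\<lambda>b. b [^] c b \<otimes> b [^] d b) B"
      using assms by (intro finprod_cong') (auto simp: int_pow_mult subset_iff)
    also have "\<dots> = h1 \<otimes> h2"
      unfolding cd using assms by (intro finprod_multf) auto
    finally have *: "finprod G (\<lambda>b. b [^] (c b + d b)) B = h1 \<otimes> h2" .
    show ?case
      by (rule range_eqI[where x = "\<lambda>b. c b + d b"]) (rule *[symmetric])
  qed
qed

text \<open>A nontrivial relation between the members of a generating set of minimal size is made smaller
  by replacing \<open>j\<close> with \<open>j \<otimes> i\<^sup>\<plusminus>\<^sup>1\<close>, as in the Euclidean algorithm, until a single exponent is left;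
  then torsion-freeness kills a generator.\<close>

lemma minimal_generators_independent:
  fixes c :: "'a \<Rightarrow> int"
  assumes torsion_free: "\<And>x k::nat. \<lbrakk>x \<in> carrier G; k > 0; x [^] k = \<one>\<rbrakk> \<Longrightarrow> x = \<one>"
    and "finite B" "B \<subseteq> carrier G" "generate G B = carrier G"
    and "\<And>B'. \<lbrakk>finite B'; B' \<subseteq> carrier G; generate G B' = carrier G\<rbrakk> \<Longrightarrow> card B \<le> card B'"
    and "finprod G (\<lambda>b. b [^] c b) B = \<one>" "b \<in> B"
  shows "c b = 0"
  using assms(2-)
proof (induction "\<Sum>b\<in>B. nat \<bar>c b\<bar>" arbitrary: B c b rule: less_induct)
  case less
  note finB = less.prems(1) and BG = less.prems(2) and genB = less.prems(3)
    and minB = less.prems(4) and rel = less.prems(5)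
  have reduce: False if ij: "i \<in> B" "j \<in> B" "i \<noteq> j" "c j \<noteq> 0" "\<bar>c j\<bar> \<le> \<bar>c i\<bar>" for i j
  proof -
    \<comment> \<open>This sign gives \<open>c i - s * c j\<close> the absolute value \<bar>c
      i\<bar> - \<bar>c j\<bar>, which is strictly smaller than that of \<open>c i\<close>.\<close>
    define s where "s = sgn (c i) * sgn (c j)"
    define j' where "j' = j \<otimes> i [^] s"
    define R where "R = B - {i, j}"
    have ic: "i \<in> carrier G" and jc: "j \<in> carrier G" and Rc: "R \<subseteq> carrier G" and finR: "finite R"
      using ij BG finB by (auto simp: R_def)
    have j'c: "j' \<in> carrier G"
      using ic jc by (simp add: j'_def)
    have B: "B = insert i (insert j R)" "i \<notin> insert j R" "j \<notin> R"
      using ij by (auto simp: R_def)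
    let ?B = "insert i (insert j' R)"
    have B'c: "?B \<subseteq> carrier G"
      using ic j'c Rc by auto
    have sub: "subgroup (generate G ?B) G"
      using B'c by (rule generate_is_subgroup)
    have "j = j' \<otimes> i [^] (- s)"
      using ic jc by (simp add: j'_def m_assoc int_pow_neg)
    moreover have "i [^] (- s) \<in> generate G ?B"
      by (rule subgroup_int_pow_closed[OF sub]) (simp add: generate.incl)
    ultimately have "j \<in> generate G ?B"
      by (metis generate.eng generate.incl insertCI)
    then have "B \<subseteq> generate G ?B"
      unfolding B(1) by (auto simp: generate.incl)
    then have gen': "generate G ?B = carrier G"
      using generate_subgroup_incl[OF _ sub] genB generate_incl[OF B'c] by blast
    then have "card B \<le> card ?B"
      using minB B'c finR by simp
    then have j'R: "j' \<notin> R" "j' \<noteq> i"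
      using B finR by (auto simp: insert_absorb split: if_splits)
    define c' where "c' = c(i := c i - s * c j, j' := c j)"
    have exchange: "i [^] (c i - s * c j) \<otimes> j' [^] c j = i [^] c i \<otimes> j [^] c j"
    proof -
      have "j' [^] c j = j [^] c j \<otimes> i [^] (s * c j)"
        unfolding j'_def using ic jc by (simp add: int_pow_distrib int_pow_pow)
      moreover have "i [^] c i = i [^] (c i - s * c j) \<otimes> i [^] (s * c j)"
        using ic by (simp flip: int_pow_mult)
      ultimately show ?thesis
        using ic jc by (simp add: m_ac)
    qed
    have R: "finprod G (\<lambda>b. b [^] c' b) R = finprod G (\<lambda>b. b [^] c b) R"
      using Rc B j'R by (intro finprod_cong') (auto simp: c'_def)
    have prodB: "finprod G (\<lambda>b. b [^] c b) B = i [^] c i \<otimes> (j [^] c j \<otimes> finprod G (\<lambda>b. b [^] c b) R)"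
      unfolding B(1) using finR ic jc Rc B(2,3) by (subst finprod_insert; auto)+
    have "c' i = c i - s * c j" "c' j' = c j"
      using j'R by (simp_all add: c'_def)
    with exchange have exchange': "i [^] c' i \<otimes> j' [^] c' j' = i [^] c i \<otimes> j [^] c j"
      by simp
    have closed: "finprod G (\<lambda>b. b [^] c b) R \<in> carrier G"
      using Rc by (intro finprod_closed) auto
    have "finprod G (\<lambda>b. b [^] c' b) ?B
        = i [^] c' i \<otimes> (j' [^] c' j' \<otimes> finprod G (\<lambda>b. b [^] c' b) R)"
    proof -
      have ni: "i \<notin> insert j' R"
        using B(2) j'R by simp
      have cl: "(\<lambda>b. b [^] c' b) \<in> A \<rightarrow> carrier G" if "A \<subseteq> carrier G" for A
        using that by auto
      have "finprod G (\<lambda>b. b [^] c' b) ?B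
          = i [^] c' i \<otimes> finprod G (\<lambda>b. b [^] c' b) (insert j' R)"
        using finR ni ic j'c Rc by (intro finprod_insert cl int_pow_closed) simp_all
      moreover have "finprod G (\<lambda>b. b [^] c' b) (insert j' R)
          = j' [^] c' j' \<otimes> finprod G (\<lambda>b. b [^] c' b) R"
        using finR j'R j'c Rc by (intro finprod_insert cl int_pow_closed)
      ultimately show ?thesis by simp
    qed
    also have "\<dots> = (i [^] c' i \<otimes> j' [^] c' j') \<otimes> finprod G (\<lambda>b. b [^] c b) R"
      unfolding R by (rule m_assoc[symmetric]) (use ic j'c closed in simp_all)
    also have "\<dots> = i [^] c i \<otimes> (j [^] c j \<otimes> finprod G (\<lambda>b. b [^] c b) R)"
      unfolding exchange' by (rule m_assoc) (use ic jc closed in simp_all)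
    finally have rel': "finprod G (\<lambda>b. b [^] c' b) ?B = \<one>"
      unfolding prodB[symmetric] rel .
    have "\<bar>c i - s * c j\<bar> < \<bar>c i\<bar>"
      using ij(4,5) by (auto simp: s_def sgn_if abs_if split: if_splits)
    moreover have "(\<Sum>b\<in>R. nat \<bar>c' b\<bar>) = (\<Sum>b\<in>R. nat \<bar>c b\<bar>)"
      using B j'R by (intro sum.cong) (auto simp: c'_def)
    ultimately have less': "(\<Sum>b\<in>?B. nat \<bar>c' b\<bar>) < (\<Sum>b\<in>B. nat \<bar>c b\<bar>)"
      unfolding B(1) using B(2,3) j'R finR ij(4) by (auto simp: c'_def)
    have "card ?B \<le> card B'" if "finite B'" "B' \<subseteq> carrier G" "generate G B' = carrier G" for B'
      using minB[OF that] B(2,3) j'R finR unfolding B(1) by simp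
    \<comment> \<open>The new relation has smaller total exponent, so the induction hypothesis
      annihilates it. But the exponent of \<open>j'\<close> is still the nonzero
      \<open>c j\<close>.\<close>
    then have "c' j' = 0"
      using less.hyps[OF less' _ B'c gen' _ rel', of j'] finR by simp
    then show False
      using ij(4) by (simp add: c'_def)
  qed
  show "c b = 0"
  proof (rule ccontr)
    assume cb: "c b \<noteq> 0"
    \<comment> \<open>Of two nonzero exponents one is at most the other in absolute value, so
      \<open>reduce\<close> applies in one of the two orders.\<close>
    have others: "c a = 0" if "a \<in> B" "a \<noteq> b" for a
      using reduce[of a b] reduce[of b a] that cb \<open>b \<in> B\<close> linorder_linear[of "\<bar>c a\<bar>" "\<bar>c b\<bar>"]
      by blast
    have bc: "b \<in> carrier G"
      using BG \<open>b \<in> B\<close> by blast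
    have "finprod G (\<lambda>a. a [^] c a) B = finprod G (\<lambda>a. if a = b then a [^] c a else \<one>) B"
      using others BG by (intro finprod_cong') auto
    also have "\<dots> = b [^] c b"
      using \<open>b \<in> B\<close> finB BG by (intro finprod_singleton_swap) auto
    finally have "b [^] c b = \<one>"
      using rel by simp
    then have "b [^] \<bar>c b\<bar> = \<one>"
      using bc by (cases "c b < 0") (simp_all add: int_pow_neg)
    then have "b [^] nat \<bar>c b\<bar> = \<one>"
      by simp
    then have "b = \<one>"
      using torsion_free[OF bc, of "nat \<bar>c b\<bar>"] cb by simp
    then have "B \<subseteq> generate G (B - {b})"
      using generate.one generate.incl by (metis Diff_iff insert_iff singletonD subsetI)
    moreover have "subgroup (generate G (B - {b})) G"
      using BG by (intro generate_is_subgroup) blast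
    ultimately have "generate G B \<subseteq> generate G (B - {b})"
      by (rule generate_subgroup_incl)
    then have "generate G (B - {b}) = carrier G"
      using genB mono_generate[of "B - {b}" B] by blast
    then have "card B \<le> card (B - {b})"
      using minB BG finB by blast
    then show False
      using finB \<open>b \<in> B\<close> by (meson card_Diff1_less linorder_not_less)
  qed
qed

text \<open>A generating set of least cardinality serves as basis: the differences of two coordinate
  vectors of one element are the exponents of a relation, and these vanish by independence.\<close>

lemma finite_free_basis_exists:
  assumes torsion_free: "\<And>x k::nat. \<lbrakk>x \<in> carrier G; k > 0; x [^] k = \<one>\<rbrakk> \<Longrightarrow> x = \<one>"
    and fg: "finite S" "S \<subseteq> carrier G" "generate G S = carrier G"
  shows "\<exists>B. finite_free_basis G B"
proof -
  let ?P = "\<lambda>B. finite B \<and> B \<subseteq> carrier G \<and> generate G B = carrier G"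
  obtain B where B: "?P B" and minB: "\<And>B'. ?P B' \<Longrightarrow> card B \<le> card B'"
    using ex_has_least_nat[of ?P S card] fg by blast
  have "\<exists>!c. integer_coords G B x c" if x: "x \<in> carrier G" for x
  proof -
    have "x \<in> range (\<lambda>c::'a \<Rightarrow> int. finprod G (\<lambda>b. b [^] c b) B)"
      using generate_subset_integer_combinations[of B] B x by blast
    then obtain c :: "'a \<Rightarrow> int" where c: "x = finprod G (\<lambda>b. b [^] c b) B" by blast
    \<comment> \<open>Coordinates are required to be extensional, which is what makes them unique as
      functions, so \<open>c\<close> is cut down to \<open>B\<close>.\<close>
    have "integer_coords G B x (restrict c B)"
      unfolding integer_coords_def c using B by (auto intro!: finprod_cong')
    moreover have "d = e" if d: "integer_coords G B x d" and e: "integer_coords G B x e" for d e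
    proof -
      have cl: "(\<lambda>b. b [^] k b) \<in> B \<rightarrow> carrier G" for k :: "'a \<Rightarrow> int"
        using B by auto
      have "finprod G (\<lambda>b. b [^] d b) B = finprod G (\<lambda>b. b [^] (d b - e b) \<otimes> b [^] e b) B"
        using B by (intro finprod_cong') (auto simp: subset_iff simp flip: int_pow_mult)
      also have "\<dots> = finprod G (\<lambda>b. b [^] (d b - e b)) B \<otimes> finprod G (\<lambda>b. b [^] e b) B"
        by (intro finprod_multf cl)
      finally have "finprod G (\<lambda>b. b [^] (d b - e b)) B \<otimes> x = x"
        using d e by (simp add: integer_coords_def)
      then have *: "finprod G (\<lambda>b. b [^] (d b - e b)) B = \<one>"
        by (subst (asm) r_cancel_one[OF x finprod_closed[OF cl]])
      have "d b - e b = 0" if "b \<in> B" for b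
        by (rule minimal_generators_independent[where c = "\<lambda>b. d b - e b",
              OF torsion_free _ _ _ _ * that]) (use B minB in auto)
      then show "d = e"
        using d e unfolding integer_coords_def by (intro PiE_ext[of d B "\<lambda>_. UNIV" e]) auto
    qed
    ultimately show ?thesis by blast
  qed
  then have "\<forall>x\<in>carrier G. \<exists>!c. integer_coords G B x c"
    by (rule ballI)
  with B have "finite_free_basis G B"
    unfolding finite_free_basis_def by (elim conjE) (intro conjI)
  then show ?thesis
    by (rule exI)
qed

lemma subgroup_torsion_subgroup: "subgroup (torsion_subgroup G) G"
proof (rule subgroup.intro)
  fix x y assume "x \<in> torsion_subgroup G" "y \<in> torsion_subgroup G"
  then obtain k l :: nat where x: "x \<in> carrier G" "k > 0" "x [^] k = \<one>"
    and y: "y \<in> carrier G" "l > 0" "y [^] l = \<one>"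
    by (auto simp: torsion_subgroup_def)
  have "x [^] (k * l) = \<one>"
    using x nat_pow_pow[of x k l] by simp
  moreover have "y [^] (k * l) = \<one>"
    using y nat_pow_pow[of y l k] by (simp add: mult.commute)
  ultimately have "(x \<otimes> y) [^] (k * l) = \<one>"
    using x y by (simp add: nat_pow_distrib)
  then show "x \<otimes> y \<in> torsion_subgroup G"
    using x y by (auto simp: torsion_subgroup_def intro!: exI[of _ "k * l"])
next
  fix x assume "x \<in> torsion_subgroup G"
  then show "inv x \<in> torsion_subgroup G"
    by (auto simp: torsion_subgroup_def nat_pow_inv)
qed (auto simp: torsion_subgroup_def)

text \<open>If the coset of \<open>x\<close> is killed by \<open>k\<close>, then the power of
  \<open>x\<close> by \<open>k\<close> is torsion, killed by some \<open>m\<close>. So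
  \<open>x\<close> is killed by \<open>k * m\<close> and its coset is trivial.\<close>

lemma torsion_free_Mod_torsion_subgroup:
  assumes "C \<in> carrier (G Mod torsion_subgroup G)" "k > 0"
    and "C [^]\<^bsub>G Mod torsion_subgroup G\<^esub> (k::nat) = \<one>\<^bsub>G Mod torsion_subgroup G\<^esub>"
  shows "C = \<one>\<^bsub>G Mod torsion_subgroup G\<^esub>"
proof -
  interpret T: normal "torsion_subgroup G" G
    using subgroup_torsion_subgroup normal_iff_subgroup by blast
  obtain x where x: "x \<in> carrier G" "C = torsion_subgroup G #> x"
    using assms(1) by (auto simp: carrier_FactGroup)
  have "torsion_subgroup G #> (x [^] k) = torsion_subgroup G"
    using assms(3) x by (simp add: T.FactGroup_pow)
  then have "x [^] k \<in> torsion_subgroup G"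
    using x by (metis coset_join1 nat_pow_closed subgroup_torsion_subgroup)
  then obtain m :: nat where m: "m > 0" "(x [^] k) [^] m = \<one>"
    unfolding torsion_subgroup_def by (elim CollectE conjE exE)
  then have "k * m > 0" "x [^] (k * m) = \<one>"
    using \<open>k > 0\<close> by (simp_all only: nat_pow_pow[OF x(1)] nat_0_less_mult_iff)
  then have "x \<in> torsion_subgroup G"
    unfolding torsion_subgroup_def using x(1) by blast
  then show ?thesis
    using x by (simp add: coset_join2 subgroup_torsion_subgroup)
qed

end

text \<open>Cosets of a finite generating set generate the torsion-free quotient. This supplies the
  basis on which a trace is computed.\<close>

lemma noetherian_group_Mod_torsion_basis:
  assumes "noetherian_group A"
  shows "\<exists>B. finite_free_basis (A Mod torsion_subgroup A) B"
proof -
  interpret comm_group A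
    using assms by (simp add: noetherian_group_def)
  interpret T: normal "torsion_subgroup A" A
    using subgroup_torsion_subgroup normal_iff_subgroup by blast
  interpret Q: comm_group "A Mod torsion_subgroup A"
    by (rule abelian_FactGroup[OF subgroup_torsion_subgroup])
  interpret q: group_hom A "A Mod torsion_subgroup A" "\<lambda>x. torsion_subgroup A #>\<^bsub>A\<^esub> x"
    by (unfold_locales) (rule T.r_coset_hom_Mod)
  obtain S where S: "finite S" "S \<subseteq> carrier A" "generate A S = carrier A"
    using assms subgroup_self unfolding noetherian_group_def by blast
  let ?S = "(\<lambda>x. torsion_subgroup A #>\<^bsub>A\<^esub> x) ` S"
  show ?thesis
  proof (rule Q.finite_free_basis_exists)
    show "finite ?S" "?S \<subseteq> carrier (A Mod torsion_subgroup A)"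
      using S by (auto simp: carrier_FactGroup)
    show "generate (A Mod torsion_subgroup A) ?S = carrier (A Mod torsion_subgroup A)"
      using q.generate_img[OF S(2)] S(3) by (simp add: carrier_FactGroup)
  qed (rule torsion_free_Mod_torsion_subgroup)
qed

section \<open>Homology over finite \<open>T\<^sub>0\<close> spaces\<close>

definition min_nbhd :: "'a topology \<Rightarrow> 'a \<Rightarrow> 'a set" where
  "min_nbhd X x = topspace X \<inter> \<Inter>{U. openin X U \<and> x \<in> U}"

lemma min_nbhd_subset: "openin X U \<Longrightarrow> x \<in> U \<Longrightarrow> min_nbhd X x \<subseteq> U"
  by (auto simp: min_nbhd_def)

lemma min_nbhd_self: "x \<in> topspace X \<Longrightarrow> x \<in> min_nbhd X x"
  by (auto simp: min_nbhd_def)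

lemma openin_min_nbhd:
  assumes "finite (topspace X)"
  shows "openin X (min_nbhd X x)"
proof -
  have "{U. openin X U \<and> x \<in> U} \<subseteq> Pow (topspace X)"
    using openin_subset by blast
  then have "finite {U. openin X U \<and> x \<in> U}"
    using assms finite_subset by blast
  then show ?thesis
    unfolding min_nbhd_def by (intro openin_Int_Inter) auto
qed

text \<open>A point of \<open>W\<close> whose minimal neighbourhood has most elements will do. If it
  lay in the minimal neighbourhood of another point \<open>y\<close> of \<open>W\<close>, the two
  neighbourhoods would coincide by cardinality, contradicting \<open>t0_space\<close>. Hence the
  rest of \<open>W\<close> is a union of minimal neighbourhoods.\<close>

lemma finite_t0_space_obtain_closed_point:
  assumes X: "finite (topspace X)" "t0_space X" and W: "openin X W" "W \<noteq> {}"
  obtains x where "x \<in> W" "openin X (W - {x})"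
proof -
  have WX: "W \<subseteq> topspace X"
    using W openin_subset by blast
  have finN: "finite (min_nbhd X y)" for y
    using X(1) by (simp add: min_nbhd_def)
  have "finite W"
    using WX X finite_subset by blast
  then have "Max ((\<lambda>y. card (min_nbhd X y)) ` W) \<in> (\<lambda>y. card (min_nbhd X y)) ` W"
    using W(2) by (intro Max_in) auto
  then obtain x where x: "x \<in> W" "card (min_nbhd X x) = Max ((\<lambda>y. card (min_nbhd X y)) ` W)"
    by auto
  then have max: "card (min_nbhd X y) \<le> card (min_nbhd X x)" if "y \<in> W" for y
    using that \<open>finite W\<close> by simp
  note x = x(1)
  have "x \<notin> min_nbhd X y" if y: "y \<in> W - {x}" for y
  proof
    assume "x \<in> min_nbhd X y"
    then have sub: "min_nbhd X x \<subseteq> min_nbhd X y"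
      by (intro min_nbhd_subset openin_min_nbhd X(1))
    then have "min_nbhd X x = min_nbhd X y"
      using max[of y] y finN by (metis DiffD1 card_seteq)
    then have "\<And>U. openin X U \<Longrightarrow> x \<in> U \<longleftrightarrow> y \<in> U"
      using x y WX min_nbhd_self[of _ X] min_nbhd_subset[of X] by (metis DiffD1 subsetD)
    moreover have "\<exists>U. openin X U \<and> (x \<notin> U \<longleftrightarrow> y \<in> U)"
      using X(2) x y WX unfolding t0_space_def by (metis DiffD1 DiffD2 singletonI subsetD)
    ultimately show False by blast
  qed
  then have "W - {x} = (\<Union>y\<in>W - {x}. min_nbhd X y)"
    using WX min_nbhd_self[of _ X] min_nbhd_subset[OF W(1)] by blast
  moreover have "openin X (\<Union>y\<in>W - {x}. min_nbhd X y)"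
    using openin_min_nbhd[OF X(1)] by blast
  ultimately show ?thesis
    using that x by metis
qed

text \<open>The step is shaped for excision: \<open>W\<close> is covered by the minimal
  neighbourhood of \<open>x\<close> and by \<open>W - {x}\<close>. The hypotheses concern the second
  set and the intersection of the two, both open with fewer points than \<open>W\<close>.\<close>

lemma finite_t0_space_openin_induct [consumes 3, case_names empty insert]:
  assumes X: "finite (topspace X)" "t0_space X" and W: "openin X W"
    and empty: "P {}"
    and step: "\<And>W x. \<lbrakk>openin X W; x \<in> W; openin X (W - {x}); min_nbhd X x \<subseteq> W;
                  P (W - {x}); P (min_nbhd X x - {x})\<rbrakk> \<Longrightarrow> P W"
  shows "P W"
  using W
proof (induction "card W" arbitrary: W rule: less_induct)
  case less
  show ?case
  proof (cases "W = {}")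
    case False
    then obtain x where x: "x \<in> W" "openin X (W - {x})"
      using finite_t0_space_obtain_closed_point[OF X less.prems] by blast
    have sub: "min_nbhd X x \<subseteq> W"
      using x less.prems by (simp add: min_nbhd_subset)
    have "finite W"
      using less.prems X(1) finite_subset openin_subset by metis
    then have small: "card (W - {x}) < card W" "card (min_nbhd X x - {x}) < card W"
      using x sub by (blast intro: psubset_card_mono)+
    have "min_nbhd X x - {x} = min_nbhd X x \<inter> (W - {x})"
      using sub by blast
    then have "openin X (min_nbhd X x - {x})"
      using openin_min_nbhd[OF X(1)] x(2) by (metis openin_Int)
    then show ?thesis
      using step[OF less.prems x sub] less.hyps small x(2) by blast
  qed (simp add: empty)
qed

text \<open>The homotopy is \<open>f\<close> for \<open>t < 1\<close> and jumps to \<open>g\<close> at \<open>t = 1\<close>.\<close>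

lemma homotopic_with_specialization:
  assumes f: "continuous_map Z Y f" and g: "continuous_map Z Y g"
    and le: "\<And>z V. \<lbrakk>z \<in> topspace Z; openin Y V; g z \<in> V\<rbrakk> \<Longrightarrow> f z \<in> V"
  shows "homotopic_with (\<lambda>_. True) Z Y f g"
proof -
  let ?I = "top_of_set {0..1::real}"
  let ?h = "\<lambda>(t::real, z). if t < 1 then f z else g z"
  have "continuous_map (prod_topology ?I Z) Y ?h"
    unfolding continuous_map
  proof (intro conjI allI impI)
    show "?h ` topspace (prod_topology ?I Z) \<subseteq> topspace Y"
      using f g by (auto simp: continuous_map_def)
  next
    fix V assume V: "openin Y V"
    let ?f = "{z \<in> topspace Z. f z \<in> V}" and ?g = "{z \<in> topspace Z. g z \<in> V}"
    \<comment> \<open>By \<open>le\<close>, the preimage of \<open>V\<close> under \<open>g\<close>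
      lies in that under \<open>f\<close>, so the box over it may extend over all of
      \<open>?I\<close>. This makes the preimage under the homotopy open.\<close>
    have "{w \<in> topspace (prod_topology ?I Z). ?h w \<in> V}
        = ({0..1} \<inter> {..<1}) \<times> ?f \<union> {0..1} \<times> ?g"
      using le V by (auto split: if_splits)
    moreover have "openin ?I ({0..1} \<inter> {..<1})"
      by (intro openin_open_Int) auto
    moreover have "openin Z ?f" "openin Z ?g"
      using f g V by (auto simp: continuous_map_def)
    ultimately show "openin (prod_topology ?I Z) {w \<in> topspace (prod_topology ?I Z). ?h w \<in> V}"
      by (auto intro!: openin_Un simp: openin_prod_Times_iff)
  qed
  then show ?thesis
    unfolding homotopic_with_def by (intro exI[of _ ?h]) auto
qed

text \<open>An open subset of the minimal neighbourhood that contains \<open>x\<close> is all of it,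
  so the identity and the constant map at \<open>x\<close> are comparable in the sense of
  \<open>homotopic_with_specialization\<close>.\<close>

lemma contractible_min_nbhd:
  assumes "x \<in> topspace X"
  shows "contractible_space (subtopology X (min_nbhd X x))"
proof -
  let ?U = "subtopology X (min_nbhd X x)"
  have x: "x \<in> topspace ?U"
    using assms min_nbhd_self by fastforce
  have "homotopic_with (\<lambda>_. True) ?U ?U id (\<lambda>_. x)"
  proof (rule homotopic_with_specialization)
    fix z V assume "z \<in> topspace ?U" "openin ?U V" "x \<in> V"
    then show "id z \<in> V"
      using min_nbhd_subset[of X _ x] by (auto simp: openin_subtopology)
  qed (use x in auto)
  then show ?thesis
    unfolding contractible_space_def by blast
qed

section \<open>Acyclic spaces\<close>

lemma acyclic_space_homotopy_equivalent:
  assumes "X homotopy_equivalent_space Y" "acyclic_space Y"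
  shows "acyclic_space X"
proof -
  have "trivial_group (reduced_homology_group p X)" for p
    using homotopy_equivalent_space_imp_isomorphic_reduced_homology_groups[OF assms(1), of p] assms(2)
    by (metis acyclic_space_def group_reduced_homology_group isomorphic_group_triviality)
  moreover have "topspace X \<noteq> {}"
    using assms unfolding acyclic_space_def homotopy_equivalent_space_def continuous_map_def by blast
  ultimately show ?thesis
    by (simp add: acyclic_space_def)
qed

lemma acyclic_space_contractible:
  "\<lbrakk>contractible_space X; topspace X \<noteq> {}\<rbrakk> \<Longrightarrow> acyclic_space X"
  by (simp add: acyclic_space_def trivial_reduced_homology_group_contractible_space)

text \<open>Reduced homology is the kernel of the map induced by collapsing to a point, so its
  triviality is injectivity. Surjectivity holds because a point is a retract of a nonempty
  space.\<close>

lemma acyclic_space_iso_point: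
  assumes "acyclic_space X"
  shows "hom_induced p X {} (discrete_topology {()}) {} (\<lambda>_. ())
    \<in> iso (homology_group p X) (homology_group p (discrete_topology {()}))"
proof -
  let ?pt = "discrete_topology {()}" and ?e = "\<lambda>_. ()"
  let ?h = "hom_induced p X {} ?pt {} ?e"
  obtain a where a: "a \<in> topspace X"
    using assms unfolding acyclic_space_def by blast
  interpret h: group_hom "homology_group p X" "homology_group p ?pt" ?h
    by (simp add: group_hom_def group_hom_axioms_def hom_induced_empty_hom)
  have "kernel (homology_group p X) (homology_group p ?pt) ?h = {\<one>\<^bsub>homology_group p X\<^esub>}"
    using assms by (simp add: acyclic_space_def trivial_group_def carrier_reduced_homology_group
        one_reduced_homology_group)
  then have "inj_on ?h (carrier (homology_group p X))"
    by (simp add: h.inj_iff_trivial_ker)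
  moreover have "retraction_map X ?pt ?e"
    unfolding retraction_map_def retraction_maps_def using a by (intro exI[of _ "\<lambda>_. a"]) auto
  then have "carrier (homology_group p ?pt) = ?h ` carrier (homology_group p X)"
    by (rule surj_hom_induced_retraction_map)
  ultimately show ?thesis
    using h.homh by (simp add: iso_def bij_betw_def)
qed

text \<open>The collapses of \<open>X\<close> and \<open>Y\<close> to a point both induce
  isomorphisms, and \<open>f\<close> commutes with them.\<close>

lemma acyclic_space_map_iso:
  assumes "acyclic_space X" "acyclic_space Y" and f: "continuous_map X Y f"
  shows "hom_induced p X {} Y {} f \<in> iso (homology_group p X) (homology_group p Y)"
proof (rule iso_cancel_left[OF acyclic_space_iso_point[OF assms(2)] hom_induced_empty_hom
      acyclic_space_iso_point[OF assms(1)]])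
  fix c
  have "continuous_map Y (discrete_topology {()}) (\<lambda>_. ())"
    by auto
  then show "hom_induced p Y {} (discrete_topology {()}) {} (\<lambda>_. ()) (hom_induced p X {} Y {} f c)
      = hom_induced p X {} (discrete_topology {()}) {} (\<lambda>_. ()) c"
    using hom_induced_compose_empty[OF f, of "discrete_topology {()}" "\<lambda>_. ()" p]
    by (simp add: o_def fun_eq_iff)
qed

section \<open>Maps of pairs and excision\<close>

text \<open>Five lemma with the relative group in the middle. The hypotheses range over all degrees
  since the sequence also passes through degree \<open>p - 1\<close>.\<close>

lemma iso_relative_homology:
  assumes f: "continuous_map X Y f" "f \<in> S \<rightarrow> T"
    and X: "\<And>p. hom_induced p X {} Y {} f \<in> iso (homology_group p X) (homology_group p Y)"
    and S: "\<And>p. hom_induced p (subtopology X S) {} (subtopology Y T) {} f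
      \<in> iso (homology_group p (subtopology X S)) (homology_group p (subtopology Y T))"
  shows "hom_induced p X S Y T f \<in> iso (relative_homology_group p X S) (relative_homology_group p Y T)"
proof (rule five_lemma_iso[OF homology_exactness_axiom_3 homology_exactness_axiom_1
      homology_exactness_axiom_2 homology_exactness_axiom_3 homology_exactness_axiom_1
      homology_exactness_axiom_2 S X hom_induced_hom S X])
  have fS: "continuous_map (subtopology X S) (subtopology Y T) f"
    using f by (auto simp: continuous_map_in_subtopology continuous_map_from_subtopology)
  have incl: "hom_induced q X {} Y {} f (hom_induced q (subtopology X S) {} X {} id x)
      = hom_induced q (subtopology Y T) {} Y {} id (hom_induced q (subtopology X S) {} (subtopology Y T) {} f x)"
    for q x
    using f fS by (simp add: hom_induced_compose' continuous_map_id_subt)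
  show "hom_induced p X {} Y {} f (hom_induced p (subtopology X S) {} X {} id x)
      = hom_induced p (subtopology Y T) {} Y {} id (hom_induced p (subtopology X S) {} (subtopology Y T) {} f x)"
    for x
    by (rule incl)
  show "hom_induced (p - 1) X {} Y {} f (hom_induced (p - 1) (subtopology X S) {} X {} id x)
      = hom_induced (p - 1) (subtopology Y T) {} Y {} id
          (hom_induced (p - 1) (subtopology X S) {} (subtopology Y T) {} f x)" for x
    by (rule incl)
  show "hom_induced p X S Y T f (hom_induced p X {} X S id x)
      = hom_induced p Y {} Y T id (hom_induced p X {} Y {} f x)" for x
    using f by (simp add: hom_induced_compose')
  show "hom_induced (p - 1) (subtopology X S) {} (subtopology Y T) {} f (hom_boundary p X S x)
      = hom_boundary p Y T (hom_induced p X S Y T f x)" for x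
    using naturality_hom_induced[OF f, of p] by (simp add: fun_eq_iff)
qed

text \<open>Five lemma with the absolute group of the large space in the middle, so the window on
  the long exact sequence starts at the relative group in degree \<open>p + 1\<close>.\<close>

lemma iso_homology_of_pair:
  assumes f: "continuous_map X Y f" "f \<in> S \<rightarrow> T"
    and X: "\<And>p. hom_induced p X S Y T f \<in> iso (relative_homology_group p X S) (relative_homology_group p Y T)"
    and S: "\<And>p. hom_induced p (subtopology X S) {} (subtopology Y T) {} f
      \<in> iso (homology_group p (subtopology X S)) (homology_group p (subtopology Y T))"
  shows "hom_induced p X {} Y {} f \<in> iso (homology_group p X) (homology_group p Y)"
proof (rule five_lemma_iso[OF _ homology_exactness_axiom_3 homology_exactness_axiom_1
      _ homology_exactness_axiom_3 homology_exactness_axiom_1 X[of "p + 1"] S hom_induced_hom X S])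
  have fS: "continuous_map (subtopology X S) (subtopology Y T) f"
    using f by (auto simp: continuous_map_in_subtopology continuous_map_from_subtopology)
  show "exact_seq ([homology_group p X, homology_group p (subtopology X S), relative_homology_group (p + 1) X S],
      [hom_induced p (subtopology X S) {} X {} id, hom_boundary (p + 1) X S])"
    using homology_exactness_axiom_2[of "p + 1" X S] by simp
  show "exact_seq ([homology_group p Y, homology_group p (subtopology Y T), relative_homology_group (p + 1) Y T],
      [hom_induced p (subtopology Y T) {} Y {} id, hom_boundary (p + 1) Y T])"
    using homology_exactness_axiom_2[of "p + 1" Y T] by simp
  show "hom_induced p X {} Y {} f (hom_induced p (subtopology X S) {} X {} id x)
      = hom_induced p (subtopology Y T) {} Y {} id (hom_induced p (subtopology X S) {} (subtopology Y T) {} f x)"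
    for x
    using f fS by (simp add: hom_induced_compose' continuous_map_id_subt)
  show "hom_induced p X S Y T f (hom_induced p X {} X S id x)
      = hom_induced p Y {} Y T id (hom_induced p X {} Y {} f x)" for x
    using f by (simp add: hom_induced_compose')
  have nat: "hom_induced (q - 1) (subtopology X S) {} (subtopology Y T) {} f (hom_boundary q X S x)
      = hom_boundary q Y T (hom_induced q X S Y T f x)" for q x
    using naturality_hom_induced[OF f, of q] by (simp add: fun_eq_iff)
  show "hom_induced (p - 1) (subtopology X S) {} (subtopology Y T) {} f (hom_boundary p X S x)
      = hom_boundary p Y T (hom_induced p X S Y T f x)" for x
    by (rule nat)
  show "hom_induced p (subtopology X S) {} (subtopology Y T) {} f (hom_boundary (p + 1) X S x)
      = hom_boundary (p + 1) Y T (hom_induced (p + 1) X S Y T f x)" for x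
    using nat[of "p + 1" x] by simp
qed

text \<open>Excise \<open>V - U\<close> from the pair formed by the union and \<open>V\<close>. It
  is closed in the union because \<open>U\<close> is open, and it lies in the open set
  \<open>V\<close>, as excision demands.\<close>

lemma open_excision:
  assumes "openin X U" "openin X V"
  shows "hom_induced p (subtopology X U) (U \<inter> V) (subtopology X (U \<union> V)) V id
    \<in> iso (relative_homology_group p (subtopology X U) (U \<inter> V))
          (relative_homology_group p (subtopology X (U \<union> V)) V)"
proof -
  let ?W = "subtopology X (U \<union> V)"
  have top: "topspace ?W = U \<union> V"
    using assms openin_subset by fastforce
  have opn: "openin ?W U" "openin ?W V"
    using assms by (simp_all add: openin_open_subtopology openin_Un)
  have "V - U = topspace ?W - U"
    using top by auto
  then have "closedin ?W (V - U)"
    using closedin_diff[OF closedin_topspace opn(1)] by (simp only:)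
  then have "?W closure_of (V - U) \<subseteq> ?W interior_of V"
    using opn by (auto simp: closure_of_closedin interior_of_openin)
  then have "hom_induced p (subtopology ?W (U \<union> V - (V - U))) (V - (V - U)) (subtopology ?W (U \<union> V)) V id
    \<in> iso (relative_homology_group p (subtopology ?W (U \<union> V - (V - U))) (V - (V - U)))
          (relative_homology_group p (subtopology ?W (U \<union> V)) V)"
    by (rule homology_excision_axiom) simp
  moreover have "(U \<union> V) \<inter> (U \<union> V - (V - U)) = U" "V - (V - U) = U \<inter> V"
    by auto
  ultimately show ?thesis
    by (simp add: subtopology_subtopology)
qed

lemma trivial_group_hom_iso:
  "\<lbrakk>trivial_group A; trivial_group B; h \<in> hom A B\<rbrakk> \<Longrightarrow> h \<in> iso A B"
  by (auto simp: trivial_group_def iso_def bij_betw_def hom_def)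

theorem homology_iso_if_iso_over_min_nbhds:
  fixes E :: "'e topology" and X :: "'a topology"
  defines "pre \<equiv> \<lambda>f W. {e \<in> topspace E. f e \<in> W}"
  assumes X: "finite (topspace X)" "t0_space X" and f: "continuous_map E X f"
    and local: "\<And>x p. x \<in> topspace X \<Longrightarrow>
      hom_induced p (subtopology E (pre f (min_nbhd X x))) {} (subtopology X (min_nbhd X x)) {} f
      \<in> iso (homology_group p (subtopology E (pre f (min_nbhd X x))))
            (homology_group p (subtopology X (min_nbhd X x)))"
    and W: "openin X W"
  shows "hom_induced p (subtopology E (pre f W)) {} (subtopology X W) {} f
    \<in> iso (homology_group p (subtopology E (pre f W))) (homology_group p (subtopology X W))"
proof -
  \<comment> \<open>All degrees are treated at once, because the five lemma mixes neighbouring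
    ones.\<close>
  have "\<forall>p. hom_induced p (subtopology E (pre f W)) {} (subtopology X W) {} f
    \<in> iso (homology_group p (subtopology E (pre f W))) (homology_group p (subtopology X W))"
    using X W
  proof (induction rule: finite_t0_space_openin_induct)
    case empty
    show ?case
      by (auto simp: pre_def intro!: trivial_group_hom_iso trivial_homology_group_empty hom_induced_empty_hom)
  next
    case (insert W x)
    define U where "U = min_nbhd X x"
    define V where "V = W - {x}"
    have x: "x \<in> topspace X"
      using insert openin_subset by blast
    have UW: "U \<subseteq> W" and VW: "V \<subseteq> W" and WUV: "U \<union> V = W"
      using insert min_nbhd_self[OF x] by (auto simp: U_def V_def)
    have UV: "U \<inter> V = min_nbhd X x - {x}"
      using UW by (auto simp: U_def V_def)
    have opn: "openin X U" "openin X V"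
      using openin_min_nbhd[OF X(1)] insert by (auto simp: U_def V_def)
    have pre_open: "openin E (pre f A)" if "openin X A" for A
      using f that by (simp add: pre_def continuous_map_def)
    have pre: "pre f U \<inter> pre f V = pre f (U \<inter> V)" "pre f U \<union> pre f V = pre f W"
      "pre f W \<inter> pre f U = pre f U" "pre f W \<inter> pre f V = pre f V"
      "pre f U \<inter> pre f (U \<inter> V) = pre f (U \<inter> V)"
      using UW VW WUV by (auto simp: pre_def)
    have dom: "W \<inter> U = U" "W \<inter> V = V" "U \<inter> (U \<inter> V) = U \<inter> V"
      using UW VW by auto
    have cont: "continuous_map (subtopology E (pre f A)) (subtopology X A) f" for A
      using f by (auto simp: continuous_map_in_subtopology continuous_map_from_subtopology pre_def)
    have fpre: "f \<in> pre f A \<rightarrow> A" for A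
      by (auto simp: pre_def)
    have excX: "hom_induced p (subtopology X U) (U \<inter> V) (subtopology X W) V id
      \<in> iso (relative_homology_group p (subtopology X U) (U \<inter> V))
            (relative_homology_group p (subtopology X W) V)" for p
      using open_excision[OF opn] by (simp add: WUV)
    have excE: "hom_induced p (subtopology E (pre f U)) (pre f (U \<inter> V)) (subtopology E (pre f W)) (pre f V) id
      \<in> iso (relative_homology_group p (subtopology E (pre f U)) (pre f (U \<inter> V)))
            (relative_homology_group p (subtopology E (pre f W)) (pre f V))" for p
      using open_excision[OF pre_open[OF opn(1)] pre_open[OF opn(2)]] by (simp add: pre)
    \<comment> \<open>Over \<open>U\<close> this is the local assumption, and over the punctured
      neighbourhood it is an induction hypothesis.\<close>
    have relU: "hom_induced p (subtopology E (pre f U)) (pre f (U \<inter> V)) (subtopology X U) (U \<inter> V) f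
      \<in> iso (relative_homology_group p (subtopology E (pre f U)) (pre f (U \<inter> V)))
            (relative_homology_group p (subtopology X U) (U \<inter> V))" for p
    proof (rule iso_relative_homology[OF cont fpre])
      fix p
      show "hom_induced p (subtopology E (pre f U)) {} (subtopology X U) {} f
        \<in> iso (homology_group p (subtopology E (pre f U))) (homology_group p (subtopology X U))"
        using local[OF x] by (simp add: U_def)
      show "hom_induced p (subtopology (subtopology E (pre f U)) (pre f (U \<inter> V))) {}
          (subtopology (subtopology X U) (U \<inter> V)) {} f
        \<in> iso (homology_group p (subtopology (subtopology E (pre f U)) (pre f (U \<inter> V))))
              (homology_group p (subtopology (subtopology X U) (U \<inter> V)))"
        using insert(6) by (simp add: subtopology_subtopology pre dom flip: UV)
    qed
    \<comment> \<open>Excision upstairs and downstairs is natural in \<open>f\<close>, so the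
      isomorphism for the small pair passes to the large one. The induction hypothesis for
      \<open>V\<close> then removes the relative term.\<close>
    have relW: "hom_induced p (subtopology E (pre f W)) (pre f V) (subtopology X W) V f
      \<in> iso (relative_homology_group p (subtopology E (pre f W)) (pre f V))
            (relative_homology_group p (subtopology X W) V)" for p
    proof (rule iso_cancel_right[OF excE hom_induced_hom iso_set_trans[OF relU excX]])
      fix c
      have 1: "continuous_map (subtopology E (pre f U)) (subtopology E (pre f W)) id"
        and 2: "continuous_map (subtopology X U) (subtopology X W) id"
        using UW by (auto simp: continuous_map_in_subtopology continuous_map_id_subt pre_def)
      have 3: "id \<in> pre f (U \<inter> V) \<rightarrow> pre f V" "id \<in> U \<inter> V \<rightarrow> V"
        by (auto simp: pre_def)
      show "hom_induced p (subtopology E (pre f W)) (pre f V) (subtopology X W) V f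
          (hom_induced p (subtopology E (pre f U)) (pre f (U \<inter> V)) (subtopology E (pre f W)) (pre f V) id c)
        = (hom_induced p (subtopology X U) (U \<inter> V) (subtopology X W) V id \<circ>
          hom_induced p (subtopology E (pre f U)) (pre f (U \<inter> V)) (subtopology X U) (U \<inter> V) f) c"
        by (simp only: hom_induced_compose'[OF 1 3(1) cont fpre] o_apply
            hom_induced_compose'[OF cont fpre 2 3(2)] comp_id id_comp)
    qed
    show ?case
    proof (intro allI iso_homology_of_pair[OF cont fpre relW])
      fix p
      show "hom_induced p (subtopology (subtopology E (pre f W)) (pre f V)) {}
          (subtopology (subtopology X W) V) {} f
        \<in> iso (homology_group p (subtopology (subtopology E (pre f W)) (pre f V)))
              (homology_group p (subtopology (subtopology X W) V))"
        using insert(5) by (simp add: subtopology_subtopology pre dom flip: V_def)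
    qed
  qed
  then show ?thesis by blast
qed

text \<open>The same induction and excision, with the isomorphism property replaced by the
  Noetherian one, which exact sequences and epimorphisms also propagate.\<close>

lemma noetherian_homology_group_openin:
  assumes X: "finite (topspace X)" "t0_space X" and W: "openin X W"
  shows "noetherian_group (homology_group p (subtopology X W))"
proof -
  have "\<forall>p. noetherian_group (homology_group p (subtopology X W))"
    using X W
  proof (induction rule: finite_t0_space_openin_induct)
    case empty
    show ?case
      by (simp add: noetherian_group_trivial trivial_homology_group_empty)
  next
    case (insert W x)
    define U where "U = min_nbhd X x"
    define V where "V = W - {x}"
    have x: "x \<in> topspace X"
      using insert openin_subset by blast
    have UW: "U \<subseteq> W" and VW: "V \<subseteq> W" and WUV: "U \<union> V = W"
      using insert min_nbhd_self[OF x] by (auto simp: U_def V_def)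
    have UV: "U \<inter> V = min_nbhd X x - {x}"
      using UW by (auto simp: U_def V_def)
    have dom: "W \<inter> U = U" "W \<inter> V = V" "U \<inter> (U \<inter> V) = U \<inter> V"
      using UW VW by auto
    have opn: "openin X U" "openin X V"
      using openin_min_nbhd[OF X(1)] insert by (auto simp: U_def V_def)
    have HU: "noetherian_group (homology_group p (subtopology X U))" for p
    \<comment> \<open>The minimal neighbourhood is contractible: its zeroth homology is the group of
      integers, and in other degrees homology equals reduced homology, which vanishes.\<close>
    proof (cases "p = 0")
      case True
      have "path_connected_space (subtopology X U)"
        unfolding U_def by (intro contractible_imp_path_connected_space contractible_min_nbhd x)
      moreover have "topspace (subtopology X U) \<noteq> {}"
        using x min_nbhd_self[OF x] by (auto simp: U_def)
      ultimately have "homology_group 0 (subtopology X U) \<cong> integer_group"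
        by (rule isomorphic_integer_zeroth_homology_group)
      then have "integer_group \<cong> homology_group 0 (subtopology X U)"
        by (simp add: group.iso_sym)
      then obtain h where "h \<in> iso integer_group (homology_group 0 (subtopology X U))"
        by (auto simp: is_iso_def)
      then show ?thesis
        using True noetherian_group_epi[OF noetherian_integer_group, of "homology_group p (subtopology X U)" h]
        by (simp add: iso_def bij_betw_def)
    next
      case False
      have "trivial_group (reduced_homology_group p (subtopology X U))"
        unfolding U_def
        by (intro trivial_reduced_homology_group_contractible_space contractible_min_nbhd x)
      then show ?thesis
        using False by (simp add: un_reduced_homology_group noetherian_group_trivial)
    qed
    have "noetherian_group (homology_group p (subtopology (subtopology X U) (U \<inter> V)))" for p
      using insert(6) by (simp add: subtopology_subtopology dom flip: UV)
    then have relU: "noetherian_group (relative_homology_group p (subtopology X U) (U \<inter> V))" for p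
      by (rule noetherian_group_exact_seq[OF homology_exactness_axiom_1 HU _ abelian_relative_homology_group])
    have relW: "noetherian_group (relative_homology_group p (subtopology X W) V)" for p
    proof (rule noetherian_group_epi[OF relU abelian_relative_homology_group hom_induced_hom])
      show "hom_induced p (subtopology X U) (U \<inter> V) (subtopology X W) V id `
          carrier (relative_homology_group p (subtopology X U) (U \<inter> V))
        = carrier (relative_homology_group p (subtopology X W) V)"
        using open_excision[OF opn, of p] by (simp add: WUV iso_def bij_betw_def)
    qed
    have HV: "noetherian_group (homology_group p (subtopology (subtopology X W) V))" for p
      using insert(5) by (simp add: subtopology_subtopology dom flip: V_def)
    show ?case
      using noetherian_group_exact_seq[OF homology_exactness_axiom_3 HV relW abelian_homology_group]
      by blast
  qed
  then show ?thesis by blast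
qed

section \<open>Graphs of multivalued maps\<close>

lemma topspace_graph_space:
  "topspace (graph_space X Y F) = {(x, y). x \<in> topspace X \<and> y \<in> topspace Y \<and> y \<in> F x}"
  by (auto simp: graph_space_def)

lemma continuous_map_graph_space_fst: "continuous_map (graph_space X Y F) X fst"
  unfolding graph_space_def by (intro continuous_map_from_subtopology continuous_map_fst)

lemma continuous_map_graph_space_snd: "continuous_map (graph_space X Y F) Y snd"
  unfolding graph_space_def by (intro continuous_map_from_subtopology continuous_map_snd)

text \<open>Strong upper semicontinuity is applied with \<open>F x\<close> itself as the bounding
  set, which need not be open in \<open>Y\<close>.\<close>

lemma susc_min_nbhd_mono:
  assumes F: "susc X Y F" and x: "x \<in> topspace X" and x': "x' \<in> min_nbhd X x"
  shows "F x' \<subseteq> F x"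
proof -
  have "openin X {z \<in> topspace X. F z \<subseteq> F x}"
    using F x by (simp add: susc_def multivalued_map_def)
  then have "min_nbhd X x \<subseteq> {z \<in> topspace X. F z \<subseteq> F x}"
    by (rule min_nbhd_subset) (use x in simp)
  then show ?thesis
    using x' by blast
qed

text \<open>Over a minimal neighbourhood of \<open>x\<close> the graph deforms onto the fibre \<open>{x} \<times> F x\<close>.\<close>

lemma acyclic_graph_over_min_nbhd:
  assumes F: "susc X (topspace Y) F" "acyclic_values X Y F" and x: "x \<in> topspace X"
  shows "acyclic_space (subtopology (graph_space X Y F)
           {e \<in> topspace (graph_space X Y F). fst e \<in> min_nbhd X x})"
proof (rule acyclic_space_homotopy_equivalent)
  let ?G = "graph_space X Y F"
  let ?E = "subtopology ?G {e \<in> topspace ?G. fst e \<in> min_nbhd X x}"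
  let ?Fx = "subtopology Y (F x)"
  show "acyclic_space ?Fx"
    using F(2) x by (simp add: acyclic_values_def)
  have Fx: "F x \<subseteq> topspace Y"
    using F(1) x by (simp add: susc_def multivalued_map_def)
  note mono = susc_min_nbhd_mono[OF F(1) x]
  have topE: "topspace ?E = {(x', y). x' \<in> min_nbhd X x \<and> x' \<in> topspace X \<and> y \<in> topspace Y \<and> y \<in> F x'}"
    by (auto simp: topspace_graph_space)
  have snd: "continuous_map ?E ?Fx snd"
    unfolding continuous_map_in_subtopology
  proof
    show "continuous_map ?E Y snd"
      by (rule continuous_map_from_subtopology[OF continuous_map_graph_space_snd])
    show "snd \<in> topspace ?E \<rightarrow> F x"
      using mono unfolding topE by fastforce
  qed
  have pair: "continuous_map ?Fx ?E (Pair x)"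
    unfolding continuous_map_in_subtopology graph_space_def
  proof (intro conjI)
    show "continuous_map ?Fx (prod_topology X Y) (Pair x)"
      using x by (simp add: continuous_map_pairwise o_def continuous_map_from_subtopology)
    show "Pair x \<in> topspace ?Fx \<rightarrow> {(x, y). x \<in> topspace X \<and> y \<in> F x}"
      using x by auto
    show "Pair x \<in> topspace ?Fx \<rightarrow> {e \<in> topspace (subtopology (prod_topology X Y) {(x, y). x \<in> topspace X \<and> y \<in> F x}).
        fst e \<in> min_nbhd X x}"
      using x min_nbhd_self[OF x] by auto
  qed
  \<comment> \<open>Sliding a point of the graph horizontally to the fibre over \<open>x\<close>
    stays in the graph by \<open>mono\<close>.\<close>
  have "homotopic_with (\<lambda>_. True) ?E ?E id (Pair x \<circ> snd)"
  proof (rule homotopic_with_specialization)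
    show "continuous_map ?E ?E (Pair x \<circ> snd)"
      by (rule continuous_map_compose[OF snd pair])
    fix z V assume z: "z \<in> topspace ?E" and V: "openin ?E V" "(Pair x \<circ> snd) z \<in> V"
    obtain V' where V': "openin ?G V'" "V = V' \<inter> {e \<in> topspace ?G. fst e \<in> min_nbhd X x}"
      using V(1) unfolding openin_subtopology by blast
    obtain O' where O': "openin (prod_topology X Y) O'" "V' = O' \<inter> {(x, y). x \<in> topspace X \<and> y \<in> F x}"
      using V'(1) unfolding graph_space_def openin_subtopology by blast
    have "(x, snd z) \<in> O'"
      using V(2) V'(2) O'(2) by simp
    \<comment> \<open>A box around the slid point has a first factor that is open and contains
      \<open>x\<close>, hence contains the minimal neighbourhood. So the original point lies in the
      box too.\<close>
    from O'(1)[unfolded openin_prod_topology_alt, rule_format, OF this]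
    obtain A B where AB: "openin X A" "openin Y B" "x \<in> A" "snd z \<in> B" "A \<times> B \<subseteq> O'"
      by (elim exE conjE)
    have "fst z \<in> A"
      using z min_nbhd_subset[OF AB(1,3)] unfolding topE by auto
    then have "z \<in> O'"
      using AB(4,5) by (metis mem_Sigma_iff prod.collapse subsetD)
    then show "id z \<in> V"
      using z V'(2) O'(2) by (auto simp: topspace_graph_space)
  qed simp
  then have 1: "homotopic_with (\<lambda>_. True) ?E ?E (Pair x \<circ> snd) id"
    by (rule homotopic_with_symD)
  have 2: "homotopic_with (\<lambda>_. True) ?Fx ?Fx (snd \<circ> Pair x) id"
    by (simp add: comp_def id_def homotopic_with_refl)
  show "?E homotopy_equivalent_space ?Fx"
    unfolding homotopy_equivalent_space_def using snd pair 1 2 by blast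
qed

text \<open>Over each minimal neighbourhood \<open>fst\<close> is a map between acyclic spaces,
  hence a homology isomorphism. The local-to-global theorem is then used with the whole space as
  open set.\<close>

theorem graph_space_fst_homology_iso:
  assumes X: "finite (topspace X)" "t0_space X"
    and F: "susc X (topspace Y) F" "acyclic_values X Y F"
  shows "hom_induced p (graph_space X Y F) {} X {} fst
    \<in> iso (homology_group p (graph_space X Y F)) (homology_group p X)"
proof -
  let ?G = "graph_space X Y F"
  have loc: "hom_induced p (subtopology ?G {e \<in> topspace ?G. fst e \<in> min_nbhd X x}) {}
      (subtopology X (min_nbhd X x)) {} fst
    \<in> iso (homology_group p (subtopology ?G {e \<in> topspace ?G. fst e \<in> min_nbhd X x}))
          (homology_group p (subtopology X (min_nbhd X x)))" if x: "x \<in> topspace X" for x p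
  proof (rule acyclic_space_map_iso[OF acyclic_graph_over_min_nbhd[OF F x]])
    have "topspace (subtopology X (min_nbhd X x)) \<noteq> {}"
      using x min_nbhd_self[OF x] by (auto simp del: subtopology_eq_discrete_topology_empty)
    then show "acyclic_space (subtopology X (min_nbhd X x))"
      by (rule acyclic_space_contractible[OF contractible_min_nbhd[OF x]])
    show "continuous_map (subtopology ?G {e \<in> topspace ?G. fst e \<in> min_nbhd X x})
        (subtopology X (min_nbhd X x)) fst"
      by (auto simp: continuous_map_in_subtopology
          intro: continuous_map_from_subtopology continuous_map_graph_space_fst)
  qed
  have all: "{e \<in> topspace ?G. fst e \<in> topspace X} = topspace ?G"
    by (auto simp: topspace_graph_space)
  show ?thesis
    using homology_iso_if_iso_over_min_nbhds[OF X continuous_map_graph_space_fst loc openin_topspace]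
    by (simp only: all subtopology_topspace)
qed

text \<open>Since \<open>p\<^sub>1\<close> and \<open>p\<^sub>2\<close> restrict along the inclusion of the graph of \<open>F\<close> into that of \<open>G\<close>, a class
  over \<open>F\<close> and its image over \<open>G\<close> have the same projections.\<close>

lemma mv_hom_induced_mono:
  assumes X: "finite (topspace X)" "t0_space X"
    and F: "susc X (topspace Y) F" "acyclic_values X Y F"
    and G: "susc X (topspace Y) G" "acyclic_values X Y G"
    and FG: "\<And>x. x \<in> topspace X \<Longrightarrow> F x \<subseteq> G x"
    and c: "c \<in> carrier (homology_group p X)"
  shows "mv_hom_induced p X Y F c = mv_hom_induced p X Y G c"
proof -
  let ?F = "graph_space X Y F" and ?G = "graph_space X Y G"
  let ?j = "hom_induced p ?F {} ?G {} id"
  let ?F1 = "hom_induced p ?F {} X {} fst" and ?G1 = "hom_induced p ?G {} X {} fst"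
  have j: "continuous_map ?F ?G id"
    unfolding graph_space_def using FG
    by (fastforce simp: continuous_map_in_subtopology continuous_map_id_subt)
  have biF: "bij_betw ?F1 (carrier (homology_group p ?F)) (carrier (homology_group p X))"
    and biG: "bij_betw ?G1 (carrier (homology_group p ?G)) (carrier (homology_group p X))"
    using graph_space_fst_homology_iso[OF X F] graph_space_fst_homology_iso[OF X G]
    by (auto simp: iso_def)
  define d where "d = inv_into (carrier (homology_group p ?F)) ?F1 c"
  have d: "d \<in> carrier (homology_group p ?F)" "?F1 d = c"
    using biF c unfolding d_def by (auto simp: bij_betw_def inv_into_into f_inv_into_f)
  have "?G1 (?j d) = c"
    using d(2) hom_induced_compose'[OF j _ continuous_map_graph_space_fst, of "{}" "{}" "{}" p d]
    by simp
  then have "inv_into (carrier (homology_group p ?G)) ?G1 c = ?j d"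
    using biG by (metis bij_betw_def hom_induced_carrier inv_into_f_f)
  moreover have "hom_induced p ?G {} Y {} snd (?j d) = hom_induced p ?F {} Y {} snd d"
    using hom_induced_compose'[OF j _ continuous_map_graph_space_snd, of "{}" "{}" "{}" p d]
    by simp
  ultimately show ?thesis
    by (simp add: mv_hom_induced_def d_def)
qed

section \<open>Slices of a homotopy\<close>

lemma graph_space_cong:
  assumes "\<And>x. x \<in> topspace X \<Longrightarrow> F x = G x"
  shows "graph_space X Y F = graph_space X Y G"
  unfolding graph_space_def using assms by (intro arg_cong[where f = "subtopology _"]) auto

text \<open>The end slices of a homotopy are known to equal the two given maps only over points of
  \<open>X\<close>, which is all that the graph sees.\<close>

lemma mv_hom_induced_cong:
  assumes "\<And>x. x \<in> topspace X \<Longrightarrow> F x = G x"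
  shows "mv_hom_induced p X Y F = mv_hom_induced p X Y G"
proof -
  have "graph_space X Y F = graph_space X Y G"
    using assms by (rule graph_space_cong)
  then show ?thesis
    by (simp add: mv_hom_induced_def)
qed

lemma susc_slice:
  assumes "susc (prod_topology X T) Y H" "t \<in> topspace T"
  shows "susc X Y (\<lambda>x. H (x, t))"
  unfolding susc_def
proof (intro conjI allI impI)
  show "multivalued_map (topspace X) Y (\<lambda>x. H (x, t))"
    using assms by (auto simp: susc_def multivalued_map_def)
  fix B assume "B \<subseteq> Y"
  then have "openin (prod_topology X T) {z \<in> topspace (prod_topology X T). H z \<subseteq> B}"
    using assms(1) by (simp add: susc_def)
  moreover have "continuous_map X (prod_topology X T) (\<lambda>x. (x, t))"
    using assms(2) by (simp add: continuous_map_pairwise o_def)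
  ultimately have "openin X {x \<in> topspace X. (x, t) \<in> {z \<in> topspace (prod_topology X T). H z \<subseteq> B}}"
    by (rule openin_continuous_map_preimage[rotated])
  moreover have "{x \<in> topspace X. (x, t) \<in> {z \<in> topspace (prod_topology X T). H z \<subseteq> B}}
      = {x \<in> topspace X. H (x, t) \<subseteq> B}"
    using assms(2) by auto
  ultimately show "openin X {x \<in> topspace X. H (x, t) \<subseteq> B}"
    by simp
qed

lemma acyclic_values_slice:
  "\<lbrakk>acyclic_values (prod_topology X T) Y H; t \<in> topspace T\<rbrakk> \<Longrightarrow> acyclic_values X Y (\<lambda>x. H (x, t))"
  by (simp add: acyclic_values_def)

text \<open>For each \<open>x\<close> the parameters \<open>s\<close> whose value at
  \<open>x\<close> lies in \<open>H (x, t)\<close> form an open set, by semicontinuity with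
  \<open>H (x, t)\<close> as bound. Finiteness of \<open>X\<close> makes the intersection over all
  \<open>x\<close> open.\<close>

lemma susc_slice_locally_decreasing:
  assumes X: "finite (topspace X)" and H: "susc (prod_topology X T) Y H" and t: "t \<in> topspace T"
  obtains N where "openin T N" "t \<in> N" "\<And>s x. \<lbrakk>s \<in> N; x \<in> topspace X\<rbrakk> \<Longrightarrow> H (x, s) \<subseteq> H (x, t)"
proof -
  have opn: "openin T {s \<in> topspace T. H (x, s) \<subseteq> H (x, t)}" if x: "x \<in> topspace X" for x
  proof -
    have "H (x, t) \<subseteq> Y"
      using H x t by (auto simp: susc_def multivalued_map_def)
    then have "openin (prod_topology X T) {z \<in> topspace (prod_topology X T). H z \<subseteq> H (x, t)}"
      using H by (simp add: susc_def)
    moreover have "continuous_map T (prod_topology X T) (Pair x)"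
      using x by (simp add: continuous_map_pairwise o_def)
    ultimately have "openin T {s \<in> topspace T. (x, s) \<in> {z \<in> topspace (prod_topology X T). H z \<subseteq> H (x, t)}}"
      by (rule openin_continuous_map_preimage[rotated])
    moreover have "{s \<in> topspace T. (x, s) \<in> {z \<in> topspace (prod_topology X T). H z \<subseteq> H (x, t)}}
        = {s \<in> topspace T. H (x, s) \<subseteq> H (x, t)}"
      using x by auto
    ultimately show ?thesis by simp
  qed
  let ?N = "topspace T \<inter> (\<Inter>x\<in>topspace X. {s \<in> topspace T. H (x, s) \<subseteq> H (x, t)})"
  have "openin T ?N"
    using X opn by (intro openin_Int_Inter) auto
  moreover have "t \<in> ?N"
    using t by auto
  ultimately show ?thesis
    using that by blast
qed

theorem mv_hom_induced_homotopic:
  assumes X: "finite (topspace X)" "t0_space X" and FG: "susc_homotopic X Y F G"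
    and c: "c \<in> carrier (homology_group p X)"
  shows "mv_hom_induced p X Y F c = mv_hom_induced p X Y G c"
proof -
  let ?I = "top_of_set {0..1::real}"
  obtain H where H: "susc (prod_topology X ?I) (topspace Y) H" "acyclic_values (prod_topology X ?I) Y H"
    and ends: "\<And>x. x \<in> topspace X \<Longrightarrow> H (x, 0) = F x \<and> H (x, 1) = G x"
    using FG unfolding susc_homotopic_def by blast
  let ?m = "\<lambda>t. mv_hom_induced p X Y (\<lambda>x. H (x, t)) c"
  have "?m 0 = ?m 1"
  \<comment> \<open>Having equal induced images of \<open>c\<close> is an equivalence relation on
    the interval. Near \<open>t\<close> it holds by comparison of nested slices, so by connectedness
    there is only one class.\<close>
  proof (rule connected_equivalence_relation[where S = "{0..1::real}" and R = "\<lambda>s t. ?m s = ?m t"])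
    fix t :: real assume t: "t \<in> {0..1}"
    then obtain N where N: "openin ?I N" "t \<in> N"
      and sub: "\<And>s x. \<lbrakk>s \<in> N; x \<in> topspace X\<rbrakk> \<Longrightarrow> H (x, s) \<subseteq> H (x, t)"
      using susc_slice_locally_decreasing[OF X(1) H(1), of t] by auto
    have "?m t = ?m s" if s: "s \<in> N" for s
    proof -
      have s': "s \<in> topspace ?I"
        using N(1) s openin_subset by blast
      have t': "t \<in> topspace ?I"
        using t by simp
      show ?thesis
        using mv_hom_induced_mono[OF X susc_slice[OF H(1) s'] acyclic_values_slice[OF H(2) s']
            susc_slice[OF H(1) t'] acyclic_values_slice[OF H(2) t'] sub[OF s] c] by simp
    qed
    then show "\<exists>N. openin ?I N \<and> t \<in> N \<and> (\<forall>s\<in>N. ?m t = ?m s)"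
      using N by blast
  qed auto
  moreover have "mv_hom_induced p X Y (\<lambda>x. H (x, 0)) = mv_hom_induced p X Y F"
    "mv_hom_induced p X Y (\<lambda>x. H (x, 1)) = mv_hom_induced p X Y G"
    by (rule mv_hom_induced_cong; simp add: ends)+
  ultimately show ?thesis by simp
qed

section \<open>Traces and Lefschetz numbers\<close>

lemma quotient_endo_cong:
  assumes "group A" "N \<subseteq> carrier A" "C \<in> carrier (A Mod N)" "\<And>x. x \<in> carrier A \<Longrightarrow> f x = g x"
  shows "quotient_endo A N f C = quotient_endo A N g C"
proof -
  interpret group A by fact
  have "C \<subseteq> carrier A"
    using assms(2,3) r_coset_subset_G by (auto simp: carrier_FactGroup)
  then have "(\<lambda>x. N #>\<^bsub>A\<^esub> f x) ` C = (\<lambda>x. N #>\<^bsub>A\<^esub> g x) ` C"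
    using assms(4) by (intro image_cong) auto
  then show ?thesis
    by (simp add: quotient_endo_def)
qed

text \<open>Since some basis exists, the choice operator returns an actual basis. It lies in the
  carrier, where \<open>f\<close> and \<open>g\<close> agree.\<close>

lemma endo_trace_cong:
  assumes "finite_free_basis A B" "\<And>x. x \<in> carrier A \<Longrightarrow> f x = g x"
  shows "endo_trace A f = endo_trace A g"
proof -
  have "finite_free_basis A (SOME B. finite_free_basis A B)"
    using assms(1) by (rule someI)
  then have "(SOME B. finite_free_basis A B) \<subseteq> carrier A"
    by (simp add: finite_free_basis_def)
  then show ?thesis
    unfolding endo_trace_def basis_trace_def using assms(2) by (intro sum.cong) auto
qed

text \<open>Finite generation of the homology is essential here: without a finite free basis, \<open>endo_trace\<close>
  would be computed from an arbitrary set, on which the two induced maps need not agree.\<close>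

lemma lefschetz_number_cong:
  assumes X: "finite (topspace X)" "t0_space X"
    and FG: "\<And>(n::nat) c. c \<in> carrier (homology_group (int n) X)
      \<Longrightarrow> mv_hom_induced (int n) X X F c = mv_hom_induced (int n) X X G c"
  shows "lefschetz_number X F = lefschetz_number X G"
proof -
  have "endo_trace (A Mod torsion_subgroup A) (quotient_endo A (torsion_subgroup A) (mv_hom_induced (int n) X X F))
      = endo_trace (A Mod torsion_subgroup A) (quotient_endo A (torsion_subgroup A) (mv_hom_induced (int n) X X G))"
    if A: "A = homology_group (int n) X" for A and n :: nat
  proof -
    have "noetherian_group A"
      using noetherian_homology_group_openin[OF X openin_topspace, of "int n"] by (simp add: A)
    then obtain B where "finite_free_basis (A Mod torsion_subgroup A) B"
      using noetherian_group_Mod_torsion_basis by blast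
    then show ?thesis
    proof (rule endo_trace_cong)
      fix C assume C: "C \<in> carrier (A Mod torsion_subgroup A)"
      show "quotient_endo A (torsion_subgroup A) (mv_hom_induced (int n) X X F) C
          = quotient_endo A (torsion_subgroup A) (mv_hom_induced (int n) X X G) C"
        by (rule quotient_endo_cong[OF _ _ C]) (auto simp: A torsion_subgroup_def FG)
    qed
  qed
  then show ?thesis
    by (simp add: lefschetz_number_def Let_def)
qed

theorem corollary8p2:
  fixes X :: "'a topology" and F G :: "'a \<Rightarrow> 'a set"
  assumes "finite (topspace X)" and "t0_space X"
    and "susc X (topspace X) F" and "acyclic_values X X F"
    and "susc X (topspace X) G" and "acyclic_values X X G"
    and "susc_homotopic X X F G"
  shows "(\<forall>n::nat. \<forall>c \<in> carrier (homology_group (int n) X).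
            mv_hom_induced (int n) X X F c = mv_hom_induced (int n) X X G c) \<and>
         lefschetz_number X F = lefschetz_number X G"
  using lefschetz_number_cong[OF assms(1,2)] mv_hom_induced_homotopic[OF assms(1,2,7)] by blast

end
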